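(* Algorithm PGM (described in the context) is a $2\log(\beta)$-approximation algorithm for the Data Store Selection problem, running in time $O\left(n_x^2+\log^3(\beta)\right)$. That is, the returned set $\tilde D$ satisfies $\phi(\tilde D)\le 2\log(\beta)\cdot\min_{D\subseteq N_x}\phi(D)$.
   Context: All logarithms are base 2. $N_x$ is a finite set of $n_x$ data stores (those giving a positive indication for a requested item $x$); each $j\in N_x$ has an access cost $c_j\ge 1$ and a misindication ratio (also called miss ratio) $\rho_j\in[0,1)$; $\beta\ge 1$ is the miss penalty. For $D\subseteq N_x$ let $c_D=\sum_{j\in D}c_j$, $\rho_D=\prod_{j\in D}\rho_j$ ($c_\emptyset=0$, $\rho_\emptyset=1$; misindications are assumed mutually independent) and let $\phi(D)=c_D+\beta\rho_D$ be the expected cost. The Data Store Selection (DSS) problem is to find $D\subseteq N_x$ minimizing $\phi(D)$. Let $r=\log\beta$. Algorithm PGM (Partition, Generate and Merge). Partition and generate: for $j=0,1,\dots,r-1$ let $N^0_j=\{d\in N_x: 2^j\le c_d<2^{j+1}\}$, sorted in non-decreasing order of miss ratio, and let $V^0_j$ be the collection of all prefixes of this order (including the empty one). Merge: for $\ell=1,\dots,\log r$ and $j=0,\dots,\frac{r}{2^\ell}-1$: initialize $V^\ell_j=\{\emptyset\}$; for each $t=1,\dots,r$, among all sets $D=A\cup B$ with $A\in V^{\ell-1}_{2j}$, $B\in V^{\ell-1}_{2j+1}$ and $c_D\in[2^{t-1},2^t)$, let $X_t$ be one minimizing $\rho_D$ (if any such $D$ exists) and add $X_t$ to $V^\ell_j$.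 Output: $\tilde D=\arg\min_{X\in V^{\log r}_0}\phi(X)$.
   Formalization: It is additionally assumed that log β is a power of two (1, 2, 4, ...): otherwise the output collection V^{log r}_0 with r = log β is undefined, and at β = 1 the claimed bound 2 log β · min φ is 0 and false. *)

theory Defs
  imports Complex_Main "HOL-Library.Monad_Syntax"
begin

section \<open>Data Store Selection\<close>

text \<open>Access costs are \<open>c\<close>, miss ratios \<open>\<rho>\<close>, the miss penalty is \<open>\<beta>\<close>.\<close>

definition exp_cost :: "('a \<Rightarrow> real) \<Rightarrow> ('a \<Rightarrow> real) \<Rightarrow> real \<Rightarrow> 'a set \<Rightarrow> real" where
  "exp_cost c \<rho> \<beta> D = sum c D + \<beta> * prod \<rho> D"

section \<open>Algorithm PGM, with arbitrary tie-breaking\<close>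

text \<open>
  The loops of the algorithm range up to \<open>r = log \<beta>\<close>, \<open>log r\<close> and \<open>r / 2\<^sup>l\<close>, so they presuppose
  that \<open>log \<beta>\<close> is a power of two.  Under this assumption the floors below are exact; they only
  turn a real number into a natural number.
\<close>

definition pgm_r :: "real \<Rightarrow> nat" where
  "pgm_r \<beta> = nat \<lfloor>log 2 \<beta>\<rfloor>"

definition pgm_levels :: "real \<Rightarrow> nat" where
  "pgm_levels \<beta> = nat \<lfloor>log 2 (real (pgm_r \<beta>))\<rfloor>"

definition cost_class :: "'a set \<Rightarrow> ('a \<Rightarrow> real) \<Rightarrow> nat \<Rightarrow> 'a set" where
  "cost_class N c j = {d \<in> N. 2 ^ j \<le> c d \<and> c d < 2 ^ (j + 1)}"

definition is_prefix_family :: "('a \<Rightarrow> real) \<Rightarrow> 'a set \<Rightarrow> 'a set set \<Rightarrow> bool" where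
  "is_prefix_family \<rho> G V \<longleftrightarrow>
     (\<exists>xs. distinct xs \<and> set xs = G \<and> sorted (map \<rho> xs) \<and>
           V = {set (take i xs) | i. i \<le> length xs})"

definition unions_in :: "('a \<Rightarrow> real) \<Rightarrow> 'a set set \<Rightarrow> 'a set set \<Rightarrow> nat \<Rightarrow> 'a set set" where
  "unions_in c U W t = {A \<union> B | A B. A \<in> U \<and> B \<in> W \<and> sum c (A \<union> B) \<in> {2 ^ (t - 1)..<2 ^ t}}"

definition is_merge ::
  "('a \<Rightarrow> real) \<Rightarrow> ('a \<Rightarrow> real) \<Rightarrow> nat \<Rightarrow> 'a set set \<Rightarrow> 'a set set \<Rightarrow> 'a set set \<Rightarrow> bool" where
  "is_merge c \<rho> r U W V \<longleftrightarrow>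
     (\<exists>X. (\<forall>t\<in>{1..r}. unions_in c U W t \<noteq> {} \<longrightarrow>
              is_arg_min (prod \<rho>) (\<lambda>D. D \<in> unions_in c U W t) (X t)) \<and>
          V = insert {} {X t | t. t \<in> {1..r} \<and> unions_in c U W t \<noteq> {}})"

text \<open>
  \<open>pgm_output N c \<rho> \<beta> D\<close>: some execution of PGM returns \<open>D\<close>.  Executions differ in how they resolve
  ties in the sorting step and in the two minimisation steps; \<open>V l j\<close> is the collection \<open>V\<^sup>l\<^sub>j\<close>.
\<close>

definition pgm_output ::
  "'a set \<Rightarrow> ('a \<Rightarrow> real) \<Rightarrow> ('a \<Rightarrow> real) \<Rightarrow> real \<Rightarrow> 'a set \<Rightarrow> bool" where
  "pgm_output N c \<rho> \<beta> D \<longleftrightarrow>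
     (\<exists>V :: nat \<Rightarrow> nat \<Rightarrow> 'a set set.
        (\<forall>j < pgm_r \<beta>. is_prefix_family \<rho> (cost_class N c j) (V 0 j)) \<and>
        (\<forall>l \<in> {1..pgm_levels \<beta>}. \<forall>j < pgm_r \<beta> div 2 ^ l.
           is_merge c \<rho> (pgm_r \<beta>) (V (l - 1) (2 * j)) (V (l - 1) (2 * j + 1)) (V l j)) \<and>
        is_arg_min (exp_cost c \<rho> \<beta>) (\<lambda>X. X \<in> V (pgm_levels \<beta>) 0) D)"

section \<open>An implementation of PGM with step counting\<close>

text \<open>
  A computation is a pair of a result and a number of steps.  The cost model is that of a real RAM:
  one step is charged for an arithmetic operation or comparison on reals or naturals (including
  powers \<open>2 ^ i\<close>), for building a list cell, tree node or record, for a lookup of \<open>c d\<close> or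
  \<open>\<rho> d\<close> together with the operation using it, and for reading or overwriting one table entry.
\<close>

type_synonym 'a timed = "'a \<times> nat"

definition step :: "'a \<Rightarrow> 'a timed" where
  "step x = (x, 1)"

definition timed_bind :: "'a timed \<Rightarrow> ('a \<Rightarrow> 'b timed) \<Rightarrow> 'b timed" where
  "timed_bind m f = (case m of (x, a) \<Rightarrow> case f x of (y, b) \<Rightarrow> (y, a + b))"

adhoc_overloading Monad_Syntax.bind \<rightleftharpoons> timed_bind

text \<open>
  Sets of stores are kept as trees, so that a disjoint union takes one step.  A candidate set \<open>D\<close>
  is stored with \<open>c\<^sub>D\<close>, \<open>\<rho>\<^sub>D\<close>, and the number \<open>t\<close> of its bucket: \<open>t = 0\<close> for the empty set, and
  \<open>2 ^ (t - 1) \<le> c\<^sub>D < 2 ^ t\<close> otherwise.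
\<close>

datatype 'a pieces = Nothing | Store 'a | Join "'a pieces" "'a pieces"

datatype 'a cand = Cand (cand_cost: real) (cand_miss: real) (bucket: nat) (pieces: "'a pieces")

definition empty_cand :: "'a cand" where
  "empty_cand = Cand 0 1 0 Nothing"

text \<open>
  The bucket of a disjoint union is the larger of the two buckets or the next one, so one
  comparison determines it.
\<close>

definition join_cand :: "'a cand \<Rightarrow> 'a cand \<Rightarrow> 'a cand timed" where
  "join_cand X Y = do {
     a \<leftarrow> step (cand_cost X + cand_cost Y);
     m \<leftarrow> step (cand_miss X * cand_miss Y);
     s \<leftarrow> step (max (bucket X) (bucket Y));
     p \<leftarrow> step (2 ^ s);
     small \<leftarrow> step (a < p);
     t \<leftarrow> step (if small then s else s + 1);
     q \<leftarrow> step (Join (pieces X) (pieces Y));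
     step (Cand a m t q)
   }"

fun select_class :: "('a \<Rightarrow> real) \<Rightarrow> nat \<Rightarrow> 'a list \<Rightarrow> 'a list timed" where
  "select_class c j [] = step []"
| "select_class c j (d # ds) = do {
     es \<leftarrow> select_class c j ds;
     p \<leftarrow> step (2 ^ j);
     lo \<leftarrow> step (p \<le> c d);
     q \<leftarrow> step (2 * p);
     hi \<leftarrow> step (c d < q);
     step (if lo \<and> hi then d # es else es)
   }"

fun insert_by :: "('a \<Rightarrow> real) \<Rightarrow> 'a \<Rightarrow> 'a list \<Rightarrow> 'a list timed" where
  "insert_by \<rho> d [] = step [d]"
| "insert_by \<rho> d (e # es) = do {
     le \<leftarrow> step (\<rho> d \<le> \<rho> e);
     if le then step (d # e # es)
     else do {
       fs \<leftarrow> insert_by \<rho> d es;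
       step (e # fs)
     }
   }"

fun sort_by :: "('a \<Rightarrow> real) \<Rightarrow> 'a list \<Rightarrow> 'a list timed" where
  "sort_by \<rho> [] = step []"
| "sort_by \<rho> (d # ds) = do {
     es \<leftarrow> sort_by \<rho> ds;
     fs \<leftarrow> insert_by \<rho> d es;
     step fs
   }"

text \<open>\<open>prefixes c \<rho> j X ds\<close>: the candidate \<open>X\<close> extended by each prefix of \<open>ds\<close>, where \<open>ds\<close> lies in
  cost class \<open>j\<close>, i.e. a single store of \<open>ds\<close> has bucket \<open>j + 1\<close>.\<close>

fun prefixes ::
  "('a \<Rightarrow> real) \<Rightarrow> ('a \<Rightarrow> real) \<Rightarrow> nat \<Rightarrow> 'a cand \<Rightarrow> 'a list \<Rightarrow> 'a cand list timed" where
  "prefixes c \<rho> j X [] = step [X]"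
| "prefixes c \<rho> j X (d # ds) = do {
     Y \<leftarrow> step (Cand (c d) (\<rho> d) (j + 1) (Store d));
     Z \<leftarrow> join_cand X Y;
     Zs \<leftarrow> prefixes c \<rho> j Z ds;
     step (X # Zs)
   }"

text \<open>\<open>generate c \<rho> ds r []\<close> computes the list \<open>[V\<^sup>0\<^sub>0, \<dots>, V\<^sup>0\<^sub>r\<^sub>-\<^sub>1]\<close>.\<close>

fun generate ::
  "('a \<Rightarrow> real) \<Rightarrow> ('a \<Rightarrow> real) \<Rightarrow> 'a list \<Rightarrow> nat \<Rightarrow> 'a cand list list \<Rightarrow> 'a cand list list timed" where
  "generate c \<rho> ds 0 Vs = step Vs"
| "generate c \<rho> ds (Suc j) Vs = do {
     es \<leftarrow> select_class c j ds;
     fs \<leftarrow> sort_by \<rho> es;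
     V \<leftarrow> prefixes c \<rho> j empty_cand fs;
     Ws \<leftarrow> step (V # Vs);
     generate c \<rho> ds j Ws
   }"

text \<open>
  A merge scans all pairs once and keeps, in a table indexed by the bucket \<open>t \<in> {1..r}\<close>, the best
  union seen so far.  The table is used single-threadedly, hence can be updated in place.
\<close>

type_synonym 'a table = "nat \<Rightarrow> 'a cand option"

definition new_table :: "nat \<Rightarrow> 'a table timed" where
  "new_table r = (\<lambda>_. None, r + 1)"

definition offer :: "nat \<Rightarrow> 'a cand \<Rightarrow> 'a table \<Rightarrow> 'a table timed" where
  "offer r Z T = do {
     lo \<leftarrow> step (1 \<le> bucket Z);
     hi \<leftarrow> step (bucket Z \<le> r);
     if lo \<and> hi then do {
       entry \<leftarrow> step (T (bucket Z));
       better \<leftarrow> step (case entry of None \<Rightarrow> True | Some X \<Rightarrow> cand_miss Z < cand_miss X);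
       step (if better then T(bucket Z := Some Z) else T)
     }
     else step T
   }"

fun scan_row :: "nat \<Rightarrow> 'a cand \<Rightarrow> 'a cand list \<Rightarrow> 'a table \<Rightarrow> 'a table timed" where
  "scan_row r X [] T = step T"
| "scan_row r X (Y # Ys) T = do {
     Z \<leftarrow> join_cand X Y;
     T' \<leftarrow> offer r Z T;
     scan_row r X Ys T'
   }"

fun scan :: "nat \<Rightarrow> 'a cand list \<Rightarrow> 'a cand list \<Rightarrow> 'a table \<Rightarrow> 'a table timed" where
  "scan r [] Ys T = step T"
| "scan r (X # Xs) Ys T = do {
     T' \<leftarrow> scan_row r X Ys T;
     scan r Xs Ys T'
   }"

fun collect :: "'a table \<Rightarrow> nat \<Rightarrow> 'a cand list \<Rightarrow> 'a cand list timed" where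
  "collect T 0 Zs = step Zs"
| "collect T (Suc t) Zs = do {
     entry \<leftarrow> step (T (Suc t));
     Zs' \<leftarrow> step (case entry of None \<Rightarrow> Zs | Some X \<Rightarrow> X # Zs);
     collect T t Zs'
   }"

definition merge :: "nat \<Rightarrow> 'a cand list \<Rightarrow> 'a cand list \<Rightarrow> 'a cand list timed" where
  "merge r Xs Ys = do {
     T \<leftarrow> new_table r;
     T' \<leftarrow> scan r Xs Ys T;
     Zs \<leftarrow> collect T' r [];
     step (empty_cand # Zs)
   }"

fun merge_level :: "nat \<Rightarrow> 'a cand list list \<Rightarrow> 'a cand list list timed" where
  "merge_level r (U # W # Vs) = do {
     X \<leftarrow> merge r U W;
     Xs \<leftarrow> merge_level r Vs;
     step (X # Xs)
   }"
| "merge_level r _ = step []"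

fun merge_levels :: "nat \<Rightarrow> nat \<Rightarrow> 'a cand list list \<Rightarrow> 'a cand list list timed" where
  "merge_levels r 0 Vs = step Vs"
| "merge_levels r (Suc l) Vs = do {
     Ws \<leftarrow> merge_level r Vs;
     merge_levels r l Ws
   }"

fun best :: "real \<Rightarrow> 'a cand \<Rightarrow> 'a cand list \<Rightarrow> 'a cand timed" where
  "best \<beta> X [] = step X"
| "best \<beta> X (Y # Ys) = do {
     m \<leftarrow> step (\<beta> * cand_miss X);
     x \<leftarrow> step (cand_cost X + m);
     n \<leftarrow> step (\<beta> * cand_miss Y);
     y \<leftarrow> step (cand_cost Y + n);
     better \<leftarrow> step (y < x);
     best \<beta> (if better then Y else X) Ys
   }"

fun list_stores :: "'a pieces \<Rightarrow> 'a list \<Rightarrow> 'a list timed" where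
  "list_stores Nothing ds = step ds"
| "list_stores (Store d) ds = step (d # ds)"
| "list_stores (Join p q) ds = do {
     es \<leftarrow> list_stores q ds;
     fs \<leftarrow> list_stores p es;
     step fs
   }"

text \<open>The search for the best candidate starts at the empty set, which belongs to every collection.\<close>

definition pgm :: "('a \<Rightarrow> real) \<Rightarrow> ('a \<Rightarrow> real) \<Rightarrow> real \<Rightarrow> 'a list \<Rightarrow> 'a list timed" where
  "pgm c \<rho> \<beta> ds = do {
     r \<leftarrow> step (pgm_r \<beta>);
     k \<leftarrow> step (pgm_levels \<beta>);
     Vs \<leftarrow> generate c \<rho> ds r [];
     Ws \<leftarrow> merge_levels r k Vs;
     V \<leftarrow> step (hd Ws);
     X \<leftarrow> best \<beta> empty_cand V;
     list_stores (pieces X) []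
   }"

end

theory Submission
  imports Defs
begin

text \<open>
  Compare with an optimal set \<open>D\<close>.  In each cost class, the prefix with as many stores as \<open>D\<close> has
  at most twice the cost and no larger miss ratio.  A merge keeps, in the bucket of the union of two
  such sets, a set of at most twice that cost and no larger miss ratio.  After \<open>log r\<close> merges the
  cost has grown by a factor of at most \<open>2 * r\<close>, which yields the bound, unless a cost left the range
  of the buckets on the way; but then \<open>2 * r * sum c D \<ge> \<beta>\<close>, and the empty set, of expected cost
  \<open>\<beta>\<close>, is good enough.

  For the running time, the prefix families of all \<open>r\<close> classes have total size at most \<open>n + r\<close>, so
  generating them and the first round of merges take \<open>O((n + r)\<^sup>2)\<close> steps.  Every later family has
  at most \<open>r + 1\<close> members, so the fewer than \<open>r\<close> remaining merges take \<open>O(r\<^sup>2)\<close> steps each.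
\<close>

section \<open>Blocks of consecutive cost classes\<close>

text \<open>The collection \<open>V l j\<close> draws its stores from the classes
  \<open>j * 2 ^ l\<close> up to, but excluding, \<open>Suc j * 2 ^ l\<close>; their union is one
  such block.\<close>

definition cost_block :: "'a set \<Rightarrow> ('a \<Rightarrow> real) \<Rightarrow> nat \<Rightarrow> nat \<Rightarrow> 'a set" where
  "cost_block N c a b = {d \<in> N. 2 ^ a \<le> c d \<and> c d < 2 ^ b}"

lemma cost_class_eq_cost_block: "cost_class N c j = cost_block N c j (Suc j)"
  by (simp add: cost_class_def cost_block_def)

lemma finite_cost_block: "finite N \<Longrightarrow> finite (cost_block N c a b)"
  by (simp add: cost_block_def)

lemma cost_block_Un:
  assumes "a \<le> b" "b \<le> e"
  shows "cost_block N c a e = cost_block N c a b \<union> cost_block N c b e"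
proof -
  have "(2::real) ^ a \<le> 2 ^ b" "(2::real) ^ b \<le> 2 ^ e"
    using assms by (simp_all add: power_increasing)
  then show ?thesis
    unfolding cost_block_def set_eq_iff Un_iff mem_Collect_eq
    by (meson le_less_linear less_le_trans order_trans)
qed

lemma cost_block_disjoint: "cost_block N c a b \<inter> cost_block N c b e = {}"
  by (auto simp: cost_block_def)

lemma block_halves:
  fixes l j :: nat
  shows "cost_block N c (j * 2 ^ Suc l) (Suc j * 2 ^ Suc l) =
    cost_block N c (2 * j * 2 ^ l) (Suc (2 * j) * 2 ^ l) \<union>
    cost_block N c (Suc (2 * j) * 2 ^ l) (Suc (Suc (2 * j)) * 2 ^ l)"
  using cost_block_Un[of "2 * j * 2 ^ l" "Suc (2 * j) * 2 ^ l" "Suc (Suc (2 * j)) * 2 ^ l" N c]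
  by (simp add: algebra_simps)

section \<open>Approximation guarantee\<close>

text \<open>Exchange argument: the prefix and \<open>D\<close> have equally many stores, so a
  bijection \<open>f\<close> sends the part of the prefix outside \<open>D\<close> to the part of
  \<open>D\<close> outside the prefix. By sortedness \<open>f\<close> never decreases the miss
  ratio, and the common part contributes the same nonnegative factor to both products.\<close>

lemma prod_take_sorted_le:
  fixes \<rho> :: "'a \<Rightarrow> real"
  assumes dist: "distinct xs" and sorted: "sorted (map \<rho> xs)"
    and nonneg: "\<And>d. d \<in> set xs \<Longrightarrow> 0 \<le> \<rho> d" and sub: "D \<subseteq> set xs"
  shows "prod \<rho> (set (take (card D) xs)) \<le> prod \<rho> D"
proof -
  let ?m = "card D"
  let ?P = "set (take ?m xs)"
  have finD: "finite D"
    using sub finite_subset by blast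
  have m: "?m \<le> length xs"
    using sub card_mono[of "set xs" D] distinct_card[OF dist] by simp
  have Psub: "?P \<subseteq> set xs"
    by (rule set_take_subset)
  have cardP: "card ?P = ?m"
    using m dist by (simp add: distinct_card)
  have le: "\<rho> x \<le> \<rho> y" if x: "x \<in> ?P" and y: "y \<in> set xs - ?P" for x y
  proof -
    obtain i where i: "i < ?m" "x = xs ! i"
      using x m by (auto simp: in_set_conv_nth)
    obtain k where k: "k < length xs" "y = xs ! k"
      using y by (auto simp: in_set_conv_nth)
    have "\<not> k < ?m"
      using y k by (auto simp: in_set_conv_nth)
    then show ?thesis
      using sorted_nth_mono[OF sorted, of i k] i k by simp
  qed
  have "card (?P - D) = card (D - ?P)"
    using cardP finD card_Diff_subset_Int[of ?P D] card_Diff_subset_Int[of D ?P]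
    by (metis Int_commute finite_Int finite_set)
  then obtain f where f: "bij_betw f (?P - D) (D - ?P)"
    using finite_same_card_bij[of "?P - D" "D - ?P"] finD by auto
  have "prod \<rho> (?P - D) \<le> prod (\<rho> \<circ> f) (?P - D)"
  proof (rule prod_mono)
    fix x assume x: "x \<in> ?P - D"
    then have "f x \<in> D - ?P"
      using f by (auto simp: bij_betw_def)
    then show "0 \<le> \<rho> x \<and> \<rho> x \<le> (\<rho> \<circ> f) x"
      using x nonneg Psub sub le by auto
  qed
  also have "\<dots> = prod \<rho> (D - ?P)"
    using prod.reindex_bij_betw[OF f, of \<rho>] by (simp add: o_def)
  finally have swap: "prod \<rho> (?P - D) \<le> prod \<rho> (D - ?P)" .
  have "prod \<rho> ?P = prod \<rho> (?P \<inter> D) * prod \<rho> (?P - D)"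
    using prod.Int_Diff[of ?P \<rho> D] by simp
  also have "\<dots> \<le> prod \<rho> (?P \<inter> D) * prod \<rho> (D - ?P)"
    using swap nonneg Psub by (intro mult_left_mono prod_nonneg) auto
  also have "\<dots> = prod \<rho> D"
    using prod.Int_Diff[OF finD, of \<rho> ?P] by (simp add: Int_commute)
  finally show ?thesis .
qed

lemma prefix_family_approx:
  assumes "is_prefix_family \<rho> (cost_class N c j) V" "D \<subseteq> cost_class N c j"
    and nonneg: "\<And>d. d \<in> N \<Longrightarrow> 0 \<le> \<rho> d"
  shows "\<exists>X\<in>V. sum c X \<le> 2 * sum c D \<and> prod \<rho> X \<le> prod \<rho> D"
proof -
  obtain xs where xs: "distinct xs" "set xs = cost_class N c j" "sorted (map \<rho> xs)"
      "V = {set (take i xs) | i. i \<le> length xs}"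
    using assms(1) by (auto simp: is_prefix_family_def)
  have m: "card D \<le> length xs"
    using assms(2) xs card_mono[OF finite_set, of D xs] distinct_card[of xs] by simp
  let ?P = "set (take (card D) xs)"
  have Psub: "?P \<subseteq> cost_class N c j"
    using set_take_subset xs(2) by metis
  have cardP: "card ?P = card D"
    using m xs(1) by (simp add: distinct_card)
  \<comment> \<open>Costs within a class differ by a factor below 2, so two sets of equal size
    differ by at most that factor in total cost.\<close>
  have "sum c ?P \<le> of_nat (card ?P) * 2 ^ (j + 1)"
    using Psub by (intro sum_bounded_above) (auto simp: cost_class_def)
  also have "\<dots> = 2 * (of_nat (card D) * 2 ^ j)"
    using cardP by simp
  also have "of_nat (card D) * 2 ^ j \<le> sum c D"
    using assms(2) by (intro sum_bounded_below) (auto simp: cost_class_def)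
  finally have "sum c ?P \<le> 2 * sum c D"
    by simp
  moreover have "prod \<rho> ?P \<le> prod \<rho> D"
    using xs assms(2) nonneg by (intro prod_take_sorted_le) (auto simp: cost_class_def)
  moreover have "?P \<in> V"
    using xs(4) m by auto
  ultimately show ?thesis by blast
qed

section \<open>A single merge on collections of sets\<close>

lemma ex_power_bucket:
  fixes a :: real
  assumes "1 \<le> a" "a < 2 ^ r"
  shows "\<exists>t\<in>{1..r}. a \<in> {2 ^ (t - 1)..<2 ^ t}"
  using assms(2)
proof (induction r)
  case 0
  then show ?case using assms(1) by simp
next
  case (Suc r)
  show ?case
  proof (cases "a < 2 ^ r")
    case True
    then show ?thesis using Suc.IH by force
  next
    case False
    then show ?thesis using Suc.prems by (intro bexI[of _ "Suc r"]) auto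
  qed
qed

lemma is_merge_subset:
  assumes "is_merge c \<rho> r U W V" "X \<in> V" "\<And>A. A \<in> U \<Longrightarrow> A \<subseteq> G" "\<And>B. B \<in> W \<Longrightarrow> B \<subseteq> H"
  shows "X \<subseteq> G \<union> H"
proof (cases "X = {}")
  case False
  obtain Xf where Xf: "\<forall>t\<in>{1..r}. unions_in c U W t \<noteq> {} \<longrightarrow>
              is_arg_min (prod \<rho>) (\<lambda>D. D \<in> unions_in c U W t) (Xf t)"
      "V = insert {} {Xf t | t. t \<in> {1..r} \<and> unions_in c U W t \<noteq> {}}"
    using assms(1) unfolding is_merge_def by blast
  then obtain t where "X \<in> unions_in c U W t"
    using False assms(2) unfolding is_arg_min_def by blast
  then obtain A B where "X = A \<union> B" "A \<in> U" "B \<in> W"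
    by (auto simp: unions_in_def)
  then show ?thesis
    using assms(3,4) by blast
qed simp

text \<open>The set kept in the bucket of \<open>A \<union> B\<close> minimises the miss ratio
  there, and its cost lies in the same dyadic interval, which costs a factor of at most 2.\<close>

lemma is_merge_approx:
  assumes merge: "is_merge c \<rho> r U W V" and A: "A \<in> U" and B: "B \<in> W"
    and small: "sum c (A \<union> B) < 2 ^ r"
    and fin: "finite (A \<union> B)" and cost: "\<And>d. d \<in> A \<union> B \<Longrightarrow> 1 \<le> c d"
  shows "\<exists>X\<in>V. sum c X \<le> 2 * sum c (A \<union> B) \<and> prod \<rho> X \<le> prod \<rho> (A \<union> B)"
proof (cases "A \<union> B = {}")
  \<comment> \<open>The empty union has cost 0 and falls into no bucket; it survives because every
    collection is initialised with the empty set.\<close>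
  case True
  then show ?thesis
    using merge by (intro bexI[of _ "{}"]) (auto simp: is_merge_def)
next
  case False
  \<comment> \<open>A nonempty union costs at least 1, the lower end of bucket 1.\<close>
  have "1 \<le> real (card (A \<union> B))"
    using False fin by (simp add: Suc_le_eq card_gt_0_iff)
  also have "\<dots> \<le> sum c (A \<union> B)"
    using sum_bounded_below[of "A \<union> B" 1 c] cost by simp
  finally obtain t where t: "t \<in> {1..r}" "sum c (A \<union> B) \<in> {2 ^ (t - 1)..<2 ^ t}"
    using ex_power_bucket small by blast
  then have mem: "A \<union> B \<in> unions_in c U W t"
    using A B by (auto simp: unions_in_def)
  obtain Xf where Xf: "\<forall>t\<in>{1..r}. unions_in c U W t \<noteq> {} \<longrightarrow>
              is_arg_min (prod \<rho>) (\<lambda>D. D \<in> unions_in c U W t) (Xf t)"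
      "V = insert {} {Xf t | t. t \<in> {1..r} \<and> unions_in c U W t \<noteq> {}}"
    using merge by (auto simp: is_merge_def)
  have arg: "is_arg_min (prod \<rho>) (\<lambda>D. D \<in> unions_in c U W t) (Xf t)"
    using Xf(1) t(1) mem by blast
  have "Xf t \<in> V"
    using Xf(2) t(1) mem by blast
  moreover have "prod \<rho> (Xf t) \<le> prod \<rho> (A \<union> B)"
    using arg mem by (auto simp: is_arg_min_linorder)
  moreover have "sum c (Xf t) \<le> 2 * sum c (A \<union> B)"
  proof -
    have "sum c (Xf t) < 2 ^ t"
      using arg by (auto simp: is_arg_min_def unions_in_def)
    also have "(2::real) ^ t = 2 * 2 ^ (t - 1)"
      using t(1) by (cases t) auto
    also have "\<dots> \<le> 2 * sum c (A \<union> B)"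
      using t(2) by simp
    finally show ?thesis by simp
  qed
  ultimately show ?thesis by blast
qed

section \<open>Complete executions for \<open>r = 2 ^ k\<close>\<close>

text \<open>The part of \<open>pgm_output\<close> before the final minimisation, with floors and
  divisions evaluated for \<open>log 2 \<beta> = 2 ^ k\<close> and levels counted from 0, so that
  induction on \<open>l\<close> applies directly.\<close>

definition pgm_run ::
  "'a set \<Rightarrow> ('a \<Rightarrow> real) \<Rightarrow> ('a \<Rightarrow> real) \<Rightarrow> nat \<Rightarrow> (nat \<Rightarrow> nat \<Rightarrow> 'a set set) \<Rightarrow> bool" where
  "pgm_run N c \<rho> k V \<longleftrightarrow>
     (\<forall>j < 2 ^ k. is_prefix_family \<rho> (cost_class N c j) (V 0 j)) \<and>
     (\<forall>l < k. \<forall>j < 2 ^ (k - Suc l).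
        is_merge c \<rho> (2 ^ k) (V l (2 * j)) (V l (Suc (2 * j))) (V (Suc l) j))"

text \<open>Sibling collections thus use disjoint blocks, so in a merge costs add up and miss ratios
  multiply.\<close>

lemma pgm_run_subset:
  assumes run: "pgm_run N c \<rho> k V" and "l \<le> k" "j < 2 ^ (k - l)" "X \<in> V l j"
  shows "X \<subseteq> cost_block N c (j * 2 ^ l) (Suc j * 2 ^ l)"
  using assms(2-)
proof (induction l arbitrary: j X)
  case 0
  then have "is_prefix_family \<rho> (cost_class N c j) (V 0 j)"
    using run by (simp add: pgm_run_def)
  then show ?case
    using 0 set_take_subset by (fastforce simp: is_prefix_family_def cost_class_eq_cost_block)
next
  case (Suc l)
  have "k - l = Suc (k - Suc l)"
    using Suc.prems by simp
  then have j: "2 * j < 2 ^ (k - l)" "Suc (2 * j) < 2 ^ (k - l)"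
    using Suc.prems by auto
  have "is_merge c \<rho> (2 ^ k) (V l (2 * j)) (V l (Suc (2 * j))) (V (Suc l) j)"
    using run Suc.prems by (simp add: pgm_run_def)
  from is_merge_subset[OF this Suc.prems(3)] show ?case
    unfolding block_halves using Suc.IH j Suc.prems by (metis Suc_leD)
qed

lemma pgm_run_empty:
  assumes "pgm_run N c \<rho> k V" "l \<le> k" "j < 2 ^ (k - l)"
  shows "{} \<in> V l j"
proof (cases l)
  case 0
  then have "is_prefix_family \<rho> (cost_class N c j) (V l j)"
    using assms by (simp add: pgm_run_def)
  then obtain xs where "V l j = {set (take i xs) | i. i \<le> length xs}"
    by (auto simp: is_prefix_family_def)
  then show ?thesis
    by (auto intro!: exI[of _ 0])
next
  case (Suc l')
  then have "is_merge c \<rho> (2 ^ k) (V l' (2 * j)) (V l' (Suc (2 * j))) (V l j)"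
    using assms by (simp add: pgm_run_def)
  then show ?thesis
    by (auto simp: is_merge_def)
qed

text \<open>The factor \<open>2 ^ Suc l\<close> is 2 for the prefix families and another 2 for each
  merge. The hypothesis \<open>small\<close> says \<open>2 * r * sum c D < 2 ^ r\<close> with
  \<open>r = 2 ^ k\<close>; it keeps every union met on the way inside the buckets
  \<open>1..r\<close>.\<close>

lemma pgm_run_approx:
  assumes run: "pgm_run N c \<rho> k V" and fin: "finite N"
    and cost: "\<And>d. d \<in> N \<Longrightarrow> 1 \<le> c d" and miss: "\<And>d. d \<in> N \<Longrightarrow> 0 \<le> \<rho> d"
    and DN: "D \<subseteq> N" and small: "2 ^ Suc k * sum c D < 2 ^ 2 ^ k"
    and "l \<le> k" "j < 2 ^ (k - l)"
  shows "\<exists>X\<in>V l j.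
    sum c X \<le> 2 ^ Suc l * sum c (D \<inter> cost_block N c (j * 2 ^ l) (Suc j * 2 ^ l)) \<and>
    prod \<rho> X \<le> prod \<rho> (D \<inter> cost_block N c (j * 2 ^ l) (Suc j * 2 ^ l))"
  using assms(7-)
proof (induction l arbitrary: j)
  case 0
  then have "is_prefix_family \<rho> (cost_class N c j) (V 0 j)"
    using run by (simp add: pgm_run_def)
  from prefix_family_approx[OF this, of "D \<inter> cost_class N c j"] miss show ?case
    by (simp add: cost_class_eq_cost_block)
next
  case (Suc l)
  have kl: "k - l = Suc (k - Suc l)"
    using Suc.prems by simp
  then have j: "2 * j < 2 ^ (k - l)" "Suc (2 * j) < 2 ^ (k - l)"
    using Suc.prems by auto
  have merge: "is_merge c \<rho> (2 ^ k) (V l (2 * j)) (V l (Suc (2 * j))) (V (Suc l) j)"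
    using run Suc.prems by (simp add: pgm_run_def)
  define G where "G = cost_block N c (2 * j * 2 ^ l) (Suc (2 * j) * 2 ^ l)"
  define H where "H = cost_block N c (Suc (2 * j) * 2 ^ l) (Suc (Suc (2 * j)) * 2 ^ l)"
  have GH: "G \<inter> H = {}" "finite G" "finite H" "G \<subseteq> N" "H \<subseteq> N" "finite D"
    unfolding G_def H_def using cost_block_disjoint fin finite_cost_block DN
    by (auto simp: cost_block_def intro: finite_subset)
  obtain A where A: "A \<in> V l (2 * j)" "sum c A \<le> 2 ^ Suc l * sum c (D \<inter> G)"
      "prod \<rho> A \<le> prod \<rho> (D \<inter> G)"
    using Suc.IH[of "2 * j"] j Suc.prems unfolding G_def by auto
  obtain B where B: "B \<in> V l (Suc (2 * j))" "sum c B \<le> 2 ^ Suc l * sum c (D \<inter> H)"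
      "prod \<rho> B \<le> prod \<rho> (D \<inter> H)"
    using Suc.IH[of "Suc (2 * j)"] j Suc.prems unfolding H_def by auto
  have sub: "A \<subseteq> G" "B \<subseteq> H"
    unfolding G_def H_def using pgm_run_subset[OF run _ _ A(1)] pgm_run_subset[OF run _ _ B(1)] j Suc.prems
    by (meson Suc_leD)+
  then have AB: "A \<inter> B = {}" "finite A" "finite B" "A \<subseteq> N" "B \<subseteq> N"
    using GH by (auto intro: finite_subset)
  have split: "D \<inter> (G \<union> H) = D \<inter> G \<union> D \<inter> H" "(D \<inter> G) \<inter> (D \<inter> H) = {}"
    using GH by auto
  have sumD: "sum c (D \<inter> (G \<union> H)) = sum c (D \<inter> G) + sum c (D \<inter> H)"
    unfolding split(1) using split(2) GH by (intro sum.union_disjoint) auto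
  have prodD: "prod \<rho> (D \<inter> (G \<union> H)) = prod \<rho> (D \<inter> G) * prod \<rho> (D \<inter> H)"
    unfolding split(1) using split(2) GH by (intro prod.union_disjoint) auto
  have sumAB: "sum c (A \<union> B) \<le> 2 ^ Suc l * sum c (D \<inter> (G \<union> H))"
    unfolding sumD using A(2) B(2) AB by (simp add: sum.union_disjoint algebra_simps)
  have prodAB: "prod \<rho> (A \<union> B) \<le> prod \<rho> (D \<inter> (G \<union> H))"
  proof -
    have "prod \<rho> (A \<union> B) = prod \<rho> A * prod \<rho> B"
      using AB by (simp add: prod.union_disjoint)
    also have "\<dots> \<le> prod \<rho> (D \<inter> G) * prod \<rho> (D \<inter> H)"
      using A(3) B(3) miss AB GH(4,5) by (intro mult_mono prod_nonneg) auto
    finally show ?thesis unfolding prodD .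
  qed
  \<comment> \<open>Coarsening the factor to \<open>2 ^ Suc k\<close> and restoring the rest of
    \<open>D\<close> gives a bound independent of the level, to which \<open>small\<close>
    applies.\<close>
  have "sum c (A \<union> B) \<le> 2 ^ Suc k * sum c D"
  proof -
    have "sum c (D \<inter> (G \<union> H)) \<le> sum c D"
      using cost DN GH by (intro sum_mono2) force+
    moreover have "0 \<le> sum c (D \<inter> (G \<union> H))"
      using cost DN by (intro sum_nonneg) force
    ultimately have "2 ^ Suc l * sum c (D \<inter> (G \<union> H)) \<le> 2 ^ Suc k * sum c D"
      using Suc.prems by (intro mult_mono power_increasing) auto
    then show ?thesis using sumAB by linarith
  qed
  then have "sum c (A \<union> B) < 2 ^ 2 ^ k"
    using small by linarith
  from is_merge_approx[OF merge A(1) B(1) this]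
  obtain X where X: "X \<in> V (Suc l) j" "sum c X \<le> 2 * sum c (A \<union> B)"
      "prod \<rho> X \<le> prod \<rho> (A \<union> B)"
    using AB cost by blast
  then have "sum c X \<le> 2 ^ Suc (Suc l) * sum c (D \<inter> (G \<union> H))"
      "prod \<rho> X \<le> prod \<rho> (D \<inter> (G \<union> H))"
    using sumAB prodAB by auto
  then show ?case
    unfolding block_halves G_def[symmetric] H_def[symmetric] using X(1) by blast
qed

lemma pgm_parameters:
  assumes "1 \<le> \<beta>" "log 2 \<beta> = 2 ^ k"
  shows "pgm_r \<beta> = 2 ^ k" "pgm_levels \<beta> = k" "\<beta> = 2 ^ 2 ^ k"
proof -
  have "\<lfloor>(2::real) ^ k\<rfloor> = 2 ^ k"
    by (metis floor_numeral_power)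
  then show r: "pgm_r \<beta> = 2 ^ k"
    unfolding pgm_r_def assms(2) by (simp add: nat_power_eq)
  show "pgm_levels \<beta> = k"
    unfolding pgm_levels_def r by (simp add: log_nat_power)
  have "\<beta> = 2 powr (log 2 \<beta>)"
    using assms(1) by simp
  also have "\<dots> = 2 powr (real (2 ^ k))"
    unfolding assms(2) by simp
  also have "\<dots> = 2 ^ 2 ^ k"
    by (rule powr_realpow) simp
  finally show "\<beta> = 2 ^ 2 ^ k" .
qed

lemma pgm_output_iff:
  assumes "1 \<le> \<beta>" "log 2 \<beta> = 2 ^ k"
  shows "pgm_output N c \<rho> \<beta> D \<longleftrightarrow>
    (\<exists>V. pgm_run N c \<rho> k V \<and> is_arg_min (exp_cost c \<rho> \<beta>) (\<lambda>X. X \<in> V k 0) D)"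
proof -
  have div: "(2::nat) ^ k div 2 ^ Suc l = 2 ^ (k - Suc l)" if "l < k" for l
    using that power_diff[of "2::nat" "Suc l" k] by simp
  have range: "(\<forall>l\<in>{1..k}. P l) \<longleftrightarrow> (\<forall>l<k. P (Suc l))" for P
    unfolding image_Suc_lessThan[symmetric] by blast
  show ?thesis
    unfolding pgm_output_def pgm_parameters(1,2)[OF assms] pgm_run_def range using div by simp
qed

lemma pgm_output_approx:
  assumes out: "pgm_output N c \<rho> \<beta> D" and fin: "finite N"
    and cost: "\<And>d. d \<in> N \<Longrightarrow> 1 \<le> c d" and miss: "\<And>d. d \<in> N \<Longrightarrow> 0 \<le> \<rho> d"
    and \<beta>: "1 \<le> \<beta>" and k: "log 2 \<beta> = 2 ^ k"
  shows "D \<subseteq> N" "E \<subseteq> N \<Longrightarrow> exp_cost c \<rho> \<beta> D \<le> 2 * log 2 \<beta> * exp_cost c \<rho> \<beta> E"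
proof -
  obtain V where run: "pgm_run N c \<rho> k V"
    and arg: "is_arg_min (exp_cost c \<rho> \<beta>) (\<lambda>X. X \<in> V k 0) D"
    using out unfolding pgm_output_iff[OF \<beta> k] by blast
  show "D \<subseteq> N"
    using pgm_run_subset[OF run, of k 0 D] arg by (auto simp: is_arg_min_def cost_block_def)
  assume E: "E \<subseteq> N"
  have best: "exp_cost c \<rho> \<beta> D \<le> exp_cost c \<rho> \<beta> X" if "X \<in> V k 0" for X
    using arg that by (auto simp: is_arg_min_linorder)
  have finE: "finite E"
    using E fin by (rule finite_subset)
  have sum0: "0 \<le> sum c E"
    using E cost by (intro sum_nonneg) force
  have prod0: "0 \<le> prod \<rho> E"
    using E miss by (intro prod_nonneg) auto
  have factor: "2 * log 2 \<beta> = 2 ^ Suc k"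
    using k by simp
  have \<beta>_eq: "\<beta> = 2 ^ 2 ^ k"
    using pgm_parameters[OF \<beta> k] by simp
  have one: "(1::real) \<le> 2 ^ Suc k"
    by (rule one_le_power) simp
  have miss_le: "\<beta> * prod \<rho> E \<le> 2 ^ Suc k * (\<beta> * prod \<rho> E)"
    using mult_right_mono[OF one, of "\<beta> * prod \<rho> E"] prod0 \<beta> by simp
  show "exp_cost c \<rho> \<beta> D \<le> 2 * log 2 \<beta> * exp_cost c \<rho> \<beta> E"
  \<comment> \<open>The threshold is \<open>2 * r * sum c E < \<beta>\<close>: below it no merge
    overflows, above it the empty set already meets the bound.\<close>
  proof (cases "2 ^ Suc k * sum c E < 2 ^ 2 ^ k")
    case True
    obtain X where X: "X \<in> V k 0" "sum c X \<le> 2 ^ Suc k * sum c (E \<inter> cost_block N c 0 (2 ^ k))"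
        "prod \<rho> X \<le> prod \<rho> (E \<inter> cost_block N c 0 (2 ^ k))"
      using pgm_run_approx[OF run fin cost miss E True, of k 0] by auto
    \<comment> \<open>Stores of cost at least \<open>\<beta>\<close> belong to no class, but here
      \<open>E\<close> has none: each of its stores costs at most
      \<open>sum c E < 2 ^ r\<close>.\<close>
    have "E \<subseteq> cost_block N c 0 (2 ^ k)"
    proof
      fix d assume d: "d \<in> E"
      have "c d \<le> sum c E"
        using finE d E cost by (intro member_le_sum) force+
      also have "\<dots> \<le> 2 ^ Suc k * sum c E"
        using mult_right_mono[OF one sum0] by simp
      finally show "d \<in> cost_block N c 0 (2 ^ k)"
        using True d E cost by (auto simp: cost_block_def)
    qed
    then have "E \<inter> cost_block N c 0 (2 ^ k) = E"
      by blast
    then have "sum c X \<le> 2 ^ Suc k * sum c E" "\<beta> * prod \<rho> X \<le> \<beta> * prod \<rho> E"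
      using X \<beta> by (auto intro: mult_left_mono)
    then have "exp_cost c \<rho> \<beta> X \<le> 2 ^ Suc k * exp_cost c \<rho> \<beta> E"
      unfolding exp_cost_def distrib_left using miss_le by linarith
    then show ?thesis
      unfolding factor using best[OF X(1)] by linarith
  next
    case False
    have "exp_cost c \<rho> \<beta> D \<le> exp_cost c \<rho> \<beta> {}"
      using best pgm_run_empty[OF run, of k 0] by simp
    also have "\<dots> = \<beta>"
      by (simp add: exp_cost_def)
    also have "\<beta> \<le> 2 ^ Suc k * sum c E"
      using False \<beta>_eq by simp
    also have "\<dots> \<le> 2 ^ Suc k * exp_cost c \<rho> \<beta> E"
      unfolding exp_cost_def using prod0 \<beta> by (intro mult_left_mono) auto
    finally show ?thesis
      unfolding factor .
  qed
qed

section \<open>Correctness of the implementation\<close>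

lemma fst_step [simp]: "fst (step x) = x"
  and snd_step [simp]: "snd (step x) = 1"
  by (simp_all add: step_def)

lemma fst_timed_bind [simp]: "fst (timed_bind m f) = fst (f (fst m))"
  and snd_timed_bind [simp]: "snd (timed_bind m f) = snd m + snd (f (fst m))"
  by (simp_all add: timed_bind_def split: prod.splits)

lemma fst_new_table [simp]: "fst (new_table r) = (\<lambda>_. None)"
  and snd_new_table [simp]: "snd (new_table r) = r + 1"
  by (simp_all add: new_table_def)

abbreviation stores :: "'a cand \<Rightarrow> 'a set" where
  "stores X \<equiv> set_pieces (pieces X)"

lemma finite_set_pieces [simp]: "finite (set_pieces p)"
  by (induction p) auto

section \<open>Buckets and the invariant of stored candidates\<close>

definition in_bucket :: "real \<Rightarrow> nat \<Rightarrow> bool" where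
  "in_bucket a t \<longleftrightarrow> (if t = 0 then a = 0 else 2 ^ (t - 1) \<le> a \<and> a < 2 ^ t)"

lemma in_bucket_less: "in_bucket a t \<Longrightarrow> a < 2 ^ t"
  by (auto simp: in_bucket_def split: if_splits)

lemma in_bucket_nonneg: "in_bucket a t \<Longrightarrow> 0 \<le> a"
  unfolding in_bucket_def by (metis order_refl order_trans zero_le_numeral zero_le_power)

text \<open>Both summands lie below \<open>2 ^ t\<close>, so the sum lies below
  \<open>2 ^ (t + 1)\<close>; since \<open>a\<close> is nonnegative, the lower bound on
  \<open>b\<close> carries over. In the case \<open>t = 0\<close> both summands vanish.\<close>

lemma in_bucket_add_le:
  assumes "in_bucket a s" "in_bucket b t" "s \<le> t"
  shows "in_bucket (a + b) (if a + b < 2 ^ t then t else t + 1)"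
proof (cases "t = 0")
  case True
  then show ?thesis using assms by (simp add: in_bucket_def)
next
  case False
  have "a < 2 ^ s" "0 \<le> a"
    using assms by (simp_all add: in_bucket_less in_bucket_nonneg)
  moreover have "(2::real) ^ s \<le> 2 ^ t"
    using assms by simp
  ultimately have "a < 2 ^ t" "0 \<le> a"
    by linarith+
  then show ?thesis
    using assms(2) False unfolding in_bucket_def by auto
qed

lemma in_bucket_add:
  assumes "in_bucket a s" "in_bucket b t"
  shows "in_bucket (a + b) (if a + b < 2 ^ max s t then max s t else max s t + 1)"
proof (cases "s \<le> t")
  case True
  then show ?thesis
    using in_bucket_add_le[OF assms] by (simp only: max_absorb2)
next
  case False
  then have "t \<le> s"
    by simp
  then show ?thesis
    using in_bucket_add_le[OF assms(2,1)] by (simp only: max_absorb1 add.commute[of b a])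
qed

lemma in_bucket_unique:
  assumes "in_bucket a s" "in_bucket a t"
  shows "s = t"
proof -
  have False if "in_bucket a i" "in_bucket a j" "i < j" for i j
  proof -
    have "a < 2 ^ i" "2 ^ (j - 1) \<le> a"
      using that in_bucket_less by (simp_all add: in_bucket_def[of a j])
    moreover have "(2::real) ^ i \<le> 2 ^ (j - 1)"
      using that by (intro power_increasing) auto
    ultimately show False by linarith
  qed
  then show ?thesis
    using assms by (meson linorder_neqE_nat)
qed

primrec num_joins :: "'a pieces \<Rightarrow> nat" where
  "num_joins Nothing = 0"
| "num_joins (Store d) = 0"
| "num_joins (Join p q) = Suc (num_joins p + num_joins q)"

text \<open>
  The number \<open>w\<close> bounds the leaves \<open>Nothing\<close> of the tree: a tree with \<open>m\<close> joins has \<open>m + 1\<close> leaves.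
\<close>

definition cand_for :: "('a \<Rightarrow> real) \<Rightarrow> ('a \<Rightarrow> real) \<Rightarrow> 'a set \<Rightarrow> nat \<Rightarrow> 'a cand \<Rightarrow> bool" where
  "cand_for c \<rho> G w X \<longleftrightarrow>
     cand_cost X = sum c (stores X) \<and> cand_miss X = prod \<rho> (stores X) \<and>
     in_bucket (cand_cost X) (bucket X) \<and> stores X \<subseteq> G \<and>
     num_joins (pieces X) < card (stores X) + w"

lemma stores_empty_cand [simp]: "stores empty_cand = {}"
  by (simp add: empty_cand_def)

lemma cand_for_empty: "0 < w \<Longrightarrow> cand_for c \<rho> G w empty_cand"
  by (simp add: cand_for_def empty_cand_def in_bucket_def)

text \<open>Width 0 is possible because the tree is a single leaf \<open>Store d\<close>: no joins,
  one store.\<close>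

lemma cand_for_store:
  assumes "d \<in> cost_class N c j" "d \<in> G"
  shows "cand_for c \<rho> G 0 (Cand (c d) (\<rho> d) (j + 1) (Store d))"
  using assms by (simp add: cand_for_def in_bucket_def cost_class_def)

lemma snd_join_cand [simp]: "snd (join_cand X Y) = 8"
  by (simp add: join_cand_def)

lemma stores_join_cand [simp]: "stores (fst (join_cand X Y)) = stores X \<union> stores Y"
  by (simp add: join_cand_def)

text \<open>Disjointness makes cost, miss ratio and cardinality compatible with the union. The
  strict inequalities on the numbers of joins leave room for the new \<open>Join\<close>.\<close>

lemma cand_for_join:
  assumes X: "cand_for c \<rho> G w X" and Y: "cand_for c \<rho> H v Y" and disj: "stores X \<inter> stores Y = {}"
  shows "cand_for c \<rho> (G \<union> H) (w + v) (fst (join_cand X Y))"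
proof -
  have "in_bucket (cand_cost X + cand_cost Y) (bucket (fst (join_cand X Y)))"
    using in_bucket_add[of "cand_cost X" "bucket X" "cand_cost Y" "bucket Y"] X Y
    unfolding cand_for_def by (auto simp: join_cand_def split: if_splits)
  then show ?thesis
    using X Y disj unfolding cand_for_def
    by (auto simp: join_cand_def sum.union_disjoint prod.union_disjoint card_Un_disjoint)
qed

subsection \<open>Prefix families\<close>

lemma fst_select_class: "fst (select_class c j ds) = filter (\<lambda>d. 2 ^ j \<le> c d \<and> c d < 2 ^ (j + 1)) ds"
  by (induction ds) auto

lemma set_select_class: "set (fst (select_class c j ds)) = cost_class (set ds) c j"
  by (auto simp: fst_select_class cost_class_def)

lemma distinct_select_class: "distinct ds \<Longrightarrow> distinct (fst (select_class c j ds))"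
  by (simp add: fst_select_class)

lemma set_insert_by [simp]: "set (fst (insert_by \<rho> d es)) = insert d (set es)"
  by (induction es) auto

lemma length_insert_by [simp]: "length (fst (insert_by \<rho> d es)) = Suc (length es)"
  by (induction es) auto

lemma distinct_insert_by: "distinct (d # es) \<Longrightarrow> distinct (fst (insert_by \<rho> d es))"
  by (induction es) auto

lemma sorted_insert_by: "sorted (map \<rho> es) \<Longrightarrow> sorted (map \<rho> (fst (insert_by \<rho> d es)))"
  by (induction es) auto

lemma set_sort_by [simp]: "set (fst (sort_by \<rho> ds)) = set ds"
  by (induction ds) auto

lemma length_sort_by [simp]: "length (fst (sort_by \<rho> ds)) = length ds"
  by (induction ds) auto

lemma distinct_sort_by: "distinct ds \<Longrightarrow> distinct (fst (sort_by \<rho> ds))"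
  by (induction ds) (auto intro!: distinct_insert_by)

lemma sorted_sort_by: "sorted (map \<rho> (fst (sort_by \<rho> ds)))"
  by (induction ds) (auto intro!: sorted_insert_by)

lemma length_prefixes [simp]: "length (fst (prefixes c \<rho> j X ds)) = Suc (length ds)"
  by (induction ds arbitrary: X) auto

lemma stores_nth_prefixes:
  "i \<le> length ds \<Longrightarrow> stores (fst (prefixes c \<rho> j X ds) ! i) = stores X \<union> set (take i ds)"
proof (induction ds arbitrary: X i)
  case (Cons d ds)
  then show ?case by (cases i) auto
qed simp

text \<open>The width stays 1: the only \<open>Nothing\<close> leaf comes from the initial
  candidate, and each extension adds a store of width 0.\<close>

lemma cand_for_prefixes:
  assumes "cand_for c \<rho> G 1 X" "distinct ds" "set ds \<subseteq> cost_class N c j" "set ds \<subseteq> G"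
    "stores X \<inter> set ds = {}" "Y \<in> set (fst (prefixes c \<rho> j X ds))"
  shows "cand_for c \<rho> G 1 Y"
  using assms
proof (induction ds arbitrary: X)
  case (Cons d ds)
  let ?Z = "fst (join_cand X (Cand (c d) (\<rho> d) (j + 1) (Store d)))"
  have "cand_for c \<rho> (G \<union> G) (1 + 0) ?Z"
    using Cons.prems by (intro cand_for_join cand_for_store[where N = N]) auto
  then have "cand_for c \<rho> G 1 ?Z"
    by simp
  with Cons show ?case by auto
qed simp

definition class_cands :: "('a \<Rightarrow> real) \<Rightarrow> ('a \<Rightarrow> real) \<Rightarrow> 'a list \<Rightarrow> nat \<Rightarrow> 'a cand list" where
  "class_cands c \<rho> ds j =
     fst (prefixes c \<rho> j empty_cand (fst (sort_by \<rho> (fst (select_class c j ds)))))"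

lemma class_cands_prefix_family:
  assumes "distinct ds"
  shows "is_prefix_family \<rho> (cost_class (set ds) c j) (stores ` set (class_cands c \<rho> ds j))"
proof -
  define xs where "xs = fst (sort_by \<rho> (fst (select_class c j ds)))"
  have len: "length (class_cands c \<rho> ds j) = Suc (length xs)"
    by (simp add: class_cands_def xs_def)
  have nth: "stores (class_cands c \<rho> ds j ! i) = set (take i xs)" if "i \<le> length xs" for i
    using stores_nth_prefixes[of i xs c \<rho> j empty_cand] that by (simp add: class_cands_def xs_def)
  have "stores ` set (class_cands c \<rho> ds j) =
      {stores (class_cands c \<rho> ds j ! i) | i. i < length (class_cands c \<rho> ds j)}"
    by (auto simp: set_conv_nth)
  also have "\<dots> = {set (take i xs) | i. i \<le> length xs}"
    unfolding len less_Suc_eq_le by (intro Collect_cong) (metis nth)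
  finally have "stores ` set (class_cands c \<rho> ds j) = {set (take i xs) | i. i \<le> length xs}" .
  moreover have "distinct xs" "sorted (map \<rho> xs)" "set xs = cost_class (set ds) c j"
    unfolding xs_def using assms
    by (simp_all add: sorted_sort_by set_select_class distinct_sort_by distinct_select_class)
  ultimately show ?thesis
    unfolding is_prefix_family_def by blast
qed

lemma class_cands_cand_for:
  assumes "distinct ds" "X \<in> set (class_cands c \<rho> ds j)"
  shows "cand_for c \<rho> (cost_class (set ds) c j) 1 X"
  using assms(2) unfolding class_cands_def
  by (rule cand_for_prefixes[where N = "set ds", rotated 5])
    (use assms(1) in \<open>simp_all add: cand_for_empty set_select_class distinct_sort_by
      distinct_select_class\<close>)

text \<open>Classes are produced from the highest index downwards and consed, which leaves them in
  increasing order.\<close>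

lemma fst_generate: "fst (generate c \<rho> ds j Vs) = map (class_cands c \<rho> ds) [0..<j] @ Vs"
  by (induction j arbitrary: Vs) (simp_all add: class_cands_def)

subsection \<open>Merging\<close>

text \<open>Loop invariant of the scan, where \<open>S\<close> collects the candidates offered so
  far.\<close>

definition best_in :: "nat \<Rightarrow> 'a cand set \<Rightarrow> 'a table \<Rightarrow> bool" where
  "best_in r S T \<longleftrightarrow> (\<forall>t\<in>{1..r}. case T t of
       None \<Rightarrow> \<forall>Z\<in>S. bucket Z \<noteq> t
     | Some X \<Rightarrow> is_arg_min cand_miss (\<lambda>Z. Z \<in> S \<and> bucket Z = t) X)"

text \<open>Only the entry at \<open>bucket Z\<close> can change. On a tie the incumbent stays,
  which is still a minimiser.\<close>

lemma best_in_offer: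
  assumes "best_in r S T"
  shows "best_in r (insert Z S) (fst (offer r Z T))"
  unfolding best_in_def
proof
  fix t assume t: "t \<in> {1..r}"
  have *: "case T t of None \<Rightarrow> \<forall>Z\<in>S. bucket Z \<noteq> t
     | Some X \<Rightarrow> is_arg_min cand_miss (\<lambda>Z. Z \<in> S \<and> bucket Z = t) X"
    using assms t by (simp add: best_in_def)
  show "case fst (offer r Z T) t of None \<Rightarrow> \<forall>Z\<in>insert Z S. bucket Z \<noteq> t
     | Some X \<Rightarrow> is_arg_min cand_miss (\<lambda>Y. Y \<in> insert Z S \<and> bucket Y = t) X"
  proof (cases "bucket Z = t")
    case False
    have "fst (offer r Z T) t = T t"
      using False by (simp add: offer_def)
    then show ?thesis
      using False * by (auto simp: is_arg_min_linorder split: option.splits)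
  next
    case True
    then have "fst (offer r Z T) t = (case T t of None \<Rightarrow> Some Z
        | Some X \<Rightarrow> if cand_miss Z < cand_miss X then Some Z else Some X)"
      using t by (auto simp: offer_def split: option.splits)
    then show ?thesis
      using True * by (force simp: is_arg_min_linorder split: option.splits)
  qed
qed

lemma best_in_scan_row:
  "best_in r S T \<Longrightarrow>
     best_in r (S \<union> (\<lambda>Y. fst (join_cand X Y)) ` set Ys) (fst (scan_row r X Ys T))"
proof (induction Ys arbitrary: S T)
  case (Cons Y Ys)
  from Cons.IH[OF best_in_offer[OF Cons.prems, of "fst (join_cand X Y)"]] show ?case
    by simp
qed simp

definition joins :: "'a cand list \<Rightarrow> 'a cand list \<Rightarrow> 'a cand set" where
  "joins Xs Ys = (\<Union>X\<in>set Xs. (\<lambda>Y. fst (join_cand X Y)) ` set Ys)"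

lemma best_in_scan:
  "best_in r S T \<Longrightarrow> best_in r (S \<union> joins Xs Ys) (fst (scan r Xs Ys T))"
proof (induction Xs arbitrary: S T)
  case (Cons X Xs)
  from Cons.IH[OF best_in_scan_row[OF Cons.prems, of X Ys]] show ?case
    by (simp add: joins_def Un_assoc)
qed (simp add: joins_def)

lemma set_collect: "set (fst (collect T t Zs)) = set Zs \<union> {X. \<exists>s\<in>{1..t}. T s = Some X}"
proof (induction t arbitrary: Zs)
  case (Suc t)
  have "{1..Suc t} = insert (Suc t) {1..t}"
    by auto
  then show ?case
    using Suc by (auto split: option.splits)
qed simp

lemma length_collect: "length (fst (collect T t Zs)) \<le> length Zs + t"
proof (induction t arbitrary: Zs)
  case (Suc t)
  show ?case
    using Suc[of Zs] Suc[of "_ # Zs"] by (auto simp: le_SucI split: option.splits)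
qed simp

lemma length_merge: "length (fst (merge r Xs Ys)) \<le> r + 1"
  using length_collect[of _ r "[]"] by (simp add: merge_def)

lemma set_mergeE:
  obtains T where "best_in r (joins Xs Ys) T"
    "set (fst (merge r Xs Ys)) = insert empty_cand {X. \<exists>t\<in>{1..r}. T t = Some X}"
proof
  show "best_in r (joins Xs Ys) (fst (scan r Xs Ys (\<lambda>_. None)))"
    using best_in_scan[of r "{}" "\<lambda>_. None" Xs Ys] by (simp add: best_in_def)
qed (simp add: merge_def set_collect)

lemma merge_cases:
  assumes "X \<in> set (fst (merge r Xs Ys))"
  shows "X = empty_cand \<or> X \<in> joins Xs Ys"
proof -
  obtain T where "best_in r (joins Xs Ys) T"
    "set (fst (merge r Xs Ys)) = insert empty_cand {X. \<exists>t\<in>{1..r}. T t = Some X}"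
    by (rule set_mergeE)
  then show ?thesis
    using assms by (force simp: best_in_def is_arg_min_def)
qed

lemma empty_cand_in_merge: "empty_cand \<in> set (fst (merge r Xs Ys))"
  by (simp add: merge_def)

lemma joins_cand_for:
  assumes Xs: "\<And>X. X \<in> set Xs \<Longrightarrow> cand_for c \<rho> G w X"
    and Ys: "\<And>Y. Y \<in> set Ys \<Longrightarrow> cand_for c \<rho> H v Y"
    and disj: "G \<inter> H = {}"
    and Z: "Z \<in> joins Xs Ys"
  shows "cand_for c \<rho> (G \<union> H) (w + v) Z"
proof -
  from Z obtain X Y where XY: "X \<in> set Xs" "Y \<in> set Ys" "Z = fst (join_cand X Y)"
    by (auto simp: joins_def)
  then have "stores X \<subseteq> G" "stores Y \<subseteq> H"
    using Xs Ys unfolding cand_for_def by blast+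
  with disj have "stores X \<inter> stores Y = {}"
    by blast
  with XY show ?thesis
    using cand_for_join[OF Xs Ys] by blast
qed

lemma merge_cand_for:
  assumes Xs: "\<And>X. X \<in> set Xs \<Longrightarrow> cand_for c \<rho> G w X"
    and Ys: "\<And>Y. Y \<in> set Ys \<Longrightarrow> cand_for c \<rho> H v Y"
    and disj: "G \<inter> H = {}"
    and "0 < w" "Z \<in> set (fst (merge r Xs Ys))"
  shows "cand_for c \<rho> (G \<union> H) (w + v) Z"
  using merge_cases[OF assms(5)] joins_cand_for[OF Xs Ys disj] cand_for_empty[of "w + v"] assms(4)
  by auto

text \<open>Links the cost intervals of the specification to the recorded bucket numbers: the
  recorded bucket is correct, and a cost has only one bucket. At \<open>t = 0\<close> the interval
  would be empty by truncated subtraction, whereas bucket 0 holds the empty candidates; hence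
  \<open>1 \<le> t\<close>.\<close>

lemma unions_in_eq_joins:
  assumes Xs: "\<And>X. X \<in> set Xs \<Longrightarrow> cand_for c \<rho> G w X"
    and Ys: "\<And>Y. Y \<in> set Ys \<Longrightarrow> cand_for c \<rho> H v Y"
    and disj: "G \<inter> H = {}"
    and "1 \<le> t"
  shows "unions_in c (stores ` set Xs) (stores ` set Ys) t = stores ` {Z \<in> joins Xs Ys. bucket Z = t}"
proof -
  have iff: "bucket Z = t \<longleftrightarrow> sum c (stores Z) \<in> {2 ^ (t - 1)..<2 ^ t}" if "Z \<in> joins Xs Ys" for Z
  proof -
    have *: "in_bucket (sum c (stores Z)) (bucket Z)"
      using joins_cand_for[OF Xs Ys disj that] unfolding cand_for_def by metis
    have "sum c (stores Z) \<in> {2 ^ (t - 1)..<2 ^ t} \<longleftrightarrow> in_bucket (sum c (stores Z)) t"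
      using assms(4) by (simp add: in_bucket_def)
    then show ?thesis
      using * in_bucket_unique by blast
  qed
  have "{Z \<in> joins Xs Ys. bucket Z = t} =
      {Z \<in> joins Xs Ys. sum c (stores Z) \<in> {2 ^ (t - 1)..<2 ^ t}}"
    using iff by blast
  moreover have "stores ` \<dots> = unions_in c (stores ` set Xs) (stores ` set Ys) t"
  proof (intro set_eqI iffI)
    fix D assume "D \<in> unions_in c (stores ` set Xs) (stores ` set Ys) t"
    then obtain X Y where "X \<in> set Xs" "Y \<in> set Ys" "D = stores X \<union> stores Y"
        "sum c D \<in> {2 ^ (t - 1)..<2 ^ t}"
      by (auto simp: unions_in_def)
    then show "D \<in> stores ` {Z \<in> joins Xs Ys. sum c (stores Z) \<in> {2 ^ (t - 1)..<2 ^ t}}"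
      by (intro image_eqI[of _ _ "fst (join_cand X Y)"]) (auto simp: joins_def)
  next
    fix D assume "D \<in> stores ` {Z \<in> joins Xs Ys. sum c (stores Z) \<in> {2 ^ (t - 1)..<2 ^ t}}"
    then obtain X Y where "X \<in> set Xs" "Y \<in> set Ys" "D = stores X \<union> stores Y"
        "sum c D \<in> {2 ^ (t - 1)..<2 ^ t}"
      by (auto simp: joins_def)
    then show "D \<in> unions_in c (stores ` set Xs) (stores ` set Ys) t"
      unfolding unions_in_def by blast
  qed
  ultimately show ?thesis by simp
qed

lemma is_merge_merge:
  assumes Xs: "\<And>X. X \<in> set Xs \<Longrightarrow> cand_for c \<rho> G w X"
    and Ys: "\<And>Y. Y \<in> set Ys \<Longrightarrow> cand_for c \<rho> H v Y"
    and disj: "G \<inter> H = {}"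
  shows "is_merge c \<rho> r (stores ` set Xs) (stores ` set Ys) (stores ` set (fst (merge r Xs Ys)))"
proof -
  let ?U = "unions_in c (stores ` set Xs) (stores ` set Ys)"
  obtain T where T: "best_in r (joins Xs Ys) T"
    "set (fst (merge r Xs Ys)) = insert empty_cand {X. \<exists>t\<in>{1..r}. T t = Some X}"
    by (rule set_mergeE)
  have arg: "\<exists>X. T t = Some X \<and> is_arg_min (prod \<rho>) (\<lambda>D. D \<in> ?U t) (stores X)"
    if t: "t \<in> {1..r}" "?U t \<noteq> {}" for t
  proof -
    obtain Z where "Z \<in> joins Xs Ys" "bucket Z = t"
      using t unions_in_eq_joins[OF Xs Ys disj, where t = t] by auto
    then obtain X where X: "T t = Some X"
        "is_arg_min cand_miss (\<lambda>Z. Z \<in> joins Xs Ys \<and> bucket Z = t) X"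
      using T(1) t(1) by (force simp: best_in_def split: option.splits)
    have "cand_miss Z = prod \<rho> (stores Z)" if "Z \<in> joins Xs Ys" for Z
      using joins_cand_for[OF Xs Ys disj that] by (simp add: cand_for_def)
    with X(2) have "is_arg_min (prod \<rho>) (\<lambda>D. D \<in> ?U t) (stores X)"
      using t(1) unions_in_eq_joins[OF Xs Ys disj, where t = t] by (auto simp: is_arg_min_linorder)
    with X(1) show ?thesis by blast
  qed
  \<comment> \<open>An empty bucket has no minimiser, so the table contributes no set beyond those
    that the specification allows.\<close>
  have none: "T t = None" if "t \<in> {1..r}" "?U t = {}" for t
  proof -
    have "{Z \<in> joins Xs Ys. bucket Z = t} = {}"
      using that unions_in_eq_joins[OF Xs Ys disj, where t = t] by simp
    then have "\<not> is_arg_min cand_miss (\<lambda>Z. Z \<in> joins Xs Ys \<and> bucket Z = t) X" for X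
      unfolding is_arg_min_def by blast
    then show ?thesis
      using T(1) that(1) unfolding best_in_def by (cases "T t") fastforce+
  qed
  \<comment> \<open>The choice function demanded by \<open>is_merge\<close>; its arbitrary value at
    an entry \<open>None\<close> does no harm, as only nonempty buckets are constrained.\<close>
  let ?X = "\<lambda>t. stores (the (T t))"
  have "stores ` set (fst (merge r Xs Ys)) = insert {} {?X t | t. t \<in> {1..r} \<and> ?U t \<noteq> {}}"
  proof -
    have "stores ` {X. \<exists>t\<in>{1..r}. T t = Some X} = {?X t | t. t \<in> {1..r} \<and> ?U t \<noteq> {}}"
    proof (intro set_eqI iffI)
      fix D assume "D \<in> stores ` {X. \<exists>t\<in>{1..r}. T t = Some X}"
      then obtain X t where "t \<in> {1..r}" "T t = Some X" "D = stores X"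
        by blast
      then show "D \<in> {?X t | t. t \<in> {1..r} \<and> ?U t \<noteq> {}}"
        using none[of t] by (intro CollectI exI[of _ t]) auto
    next
      fix D assume "D \<in> {?X t | t. t \<in> {1..r} \<and> ?U t \<noteq> {}}"
      then obtain t where t: "t \<in> {1..r}" "?U t \<noteq> {}" "D = ?X t"
        by blast
      moreover obtain X where "T t = Some X"
        using arg[OF t(1,2)] by blast
      ultimately show "D \<in> stores ` {X. \<exists>t\<in>{1..r}. T t = Some X}"
        by (intro image_eqI[of _ _ X]) auto
    qed
    then show ?thesis
      unfolding T(2) by simp
  qed
  moreover have "\<forall>t\<in>{1..r}. ?U t \<noteq> {} \<longrightarrow> is_arg_min (prod \<rho>) (\<lambda>D. D \<in> ?U t) (?X t)"
    using arg by fastforce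
  ultimately show ?thesis
    unfolding is_merge_def by (intro exI[of _ ?X]) blast
qed

section \<open>All levels of merges\<close>

lemma length_merge_level: "length (fst (merge_level r Vs)) = length Vs div 2"
  by (induction r Vs rule: merge_level.induct) auto

lemma nth_merge_level:
  "Suc (2 * j) < length Vs \<Longrightarrow>
     fst (merge_level r Vs) ! j = fst (merge r (Vs ! (2 * j)) (Vs ! Suc (2 * j)))"
proof (induction r Vs arbitrary: j rule: merge_level.induct)
  case (1 r U W Vs)
  then show ?case by (cases j) auto
qed auto

definition level_cands ::
  "('a \<Rightarrow> real) \<Rightarrow> ('a \<Rightarrow> real) \<Rightarrow> 'a list \<Rightarrow> nat \<Rightarrow> nat \<Rightarrow> 'a cand list list" where
  "level_cands c \<rho> ds r l = ((\<lambda>Vs. fst (merge_level r Vs)) ^^ l) (fst (generate c \<rho> ds r []))"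

lemma fst_merge_levels: "fst (merge_levels r l Vs) = ((\<lambda>Vs. fst (merge_level r Vs)) ^^ l) Vs"
  by (induction l arbitrary: Vs) (simp_all add: funpow_Suc_right del: funpow.simps)

lemma level_cands_Suc: "level_cands c \<rho> ds r (Suc l) = fst (merge_level r (level_cands c \<rho> ds r l))"
  by (simp add: level_cands_def)

text \<open>\<open>merge_level\<close> drops an unpaired last family. The length is a power of two
  at every level, so this never happens before a single family is left.\<close>

lemma length_level_cands: "l \<le> k \<Longrightarrow> length (level_cands c \<rho> ds (2 ^ k) l) = 2 ^ (k - l)"
proof (induction l)
  case 0
  then show ?case by (simp add: level_cands_def fst_generate)
next
  case (Suc l)
  then have "k - l = Suc (k - Suc l)"
    by simp
  then show ?case
    using Suc by (simp add: level_cands_Suc length_merge_level)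
qed

lemma nth_level_cands:
  assumes "l < k" "j < 2 ^ (k - Suc l)"
  shows "level_cands c \<rho> ds (2 ^ k) (Suc l) ! j =
    fst (merge (2 ^ k) (level_cands c \<rho> ds (2 ^ k) l ! (2 * j)) (level_cands c \<rho> ds (2 ^ k) l ! Suc (2 * j)))"
proof -
  have "k - l = Suc (k - Suc l)"
    using assms by simp
  then have "Suc (2 * j) < 2 ^ (k - l)"
    using assms by auto
  then show ?thesis
    using assms by (simp add: level_cands_Suc nth_merge_level length_level_cands)
qed

text \<open>The width doubles with each merge: a candidate of level \<open>l\<close> combines at
  most one \<open>Nothing\<close> leaf from each of its \<open>2 ^ l\<close> classes.\<close>

lemma level_cands_cand_for:
  assumes "distinct ds"
  shows "l \<le> k \<Longrightarrow> j < 2 ^ (k - l) \<Longrightarrow> X \<in> set (level_cands c \<rho> ds (2 ^ k) l ! j) \<Longrightarrow>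
    cand_for c \<rho> (cost_block (set ds) c (j * 2 ^ l) (Suc j * 2 ^ l)) (2 ^ l) X"
proof (induction l arbitrary: j X)
  case 0
  then show ?case
    using class_cands_cand_for[OF assms]
    by (auto simp: level_cands_def fst_generate nth_append cost_class_eq_cost_block)
next
  case (Suc l)
  have "k - l = Suc (k - Suc l)"
    using Suc.prems by simp
  then have j: "2 * j < 2 ^ (k - l)" "Suc (2 * j) < 2 ^ (k - l)"
    using Suc.prems by auto
  have "cand_for c \<rho>
      (cost_block (set ds) c (2 * j * 2 ^ l) (Suc (2 * j) * 2 ^ l) \<union>
       cost_block (set ds) c (Suc (2 * j) * 2 ^ l) (Suc (Suc (2 * j)) * 2 ^ l)) (2 ^ l + 2 ^ l) X"
  proof (rule merge_cand_for)
    show "X \<in> set (fst (merge (2 ^ k) (level_cands c \<rho> ds (2 ^ k) l ! (2 * j))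
        (level_cands c \<rho> ds (2 ^ k) l ! Suc (2 * j))))"
      using Suc.prems by (simp add: nth_level_cands)
  qed (use Suc.IH Suc.prems(1) j cost_block_disjoint in \<open>simp_all del: mult_Suc\<close>)
  then show ?case
    unfolding block_halves by (simp add: mult_2)
qed

lemma pgm_run_level_cands:
  assumes "distinct ds"
  shows "pgm_run (set ds) c \<rho> k (\<lambda>l j. stores ` set (level_cands c \<rho> ds (2 ^ k) l ! j))"
  unfolding pgm_run_def
proof (intro conjI allI impI)
  fix j :: nat assume "j < 2 ^ k"
  then show "is_prefix_family \<rho> (cost_class (set ds) c j) (stores ` set (level_cands c \<rho> ds (2 ^ k) 0 ! j))"
    using class_cands_prefix_family[OF assms] by (simp add: level_cands_def fst_generate)
next
  fix l j :: nat assume lj: "l < k" "j < 2 ^ (k - Suc l)"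
  have "k - l = Suc (k - Suc l)"
    using lj by simp
  then have j: "2 * j < 2 ^ (k - l)" "Suc (2 * j) < 2 ^ (k - l)"
    using lj by auto
  show "is_merge c \<rho> (2 ^ k) (stores ` set (level_cands c \<rho> ds (2 ^ k) l ! (2 * j)))
      (stores ` set (level_cands c \<rho> ds (2 ^ k) l ! Suc (2 * j)))
      (stores ` set (level_cands c \<rho> ds (2 ^ k) (Suc l) ! j))"
    unfolding nth_level_cands[OF lj]
    by (rule is_merge_merge[OF level_cands_cand_for[OF assms] level_cands_cand_for[OF assms]
          cost_block_disjoint]) (use lj j in auto)
qed

section \<open>Choice of the output\<close>

text \<open>The loser of the comparison is not below the winner, so putting it back preserves every
  minimiser.\<close>

lemma is_arg_min_insert_step:
  fixes f :: "'b \<Rightarrow> 'c::linorder"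
  shows "is_arg_min f (\<lambda>z. z \<in> insert (if f y < f x then y else x) S) m \<Longrightarrow>
    is_arg_min f (\<lambda>z. z \<in> insert x (insert y S)) m"
  by (cases "f y < f x") (auto simp: is_arg_min_linorder)

lemma best_arg_min:
  "is_arg_min (\<lambda>X. cand_cost X + \<beta> * cand_miss X) (\<lambda>Z. Z \<in> insert X (set Ys)) (fst (best \<beta> X Ys))"
proof (induction Ys arbitrary: X)
  case (Cons Y Ys)
  let ?f = "\<lambda>X. cand_cost X + \<beta> * cand_miss X"
  have "fst (best \<beta> X (Y # Ys)) = fst (best \<beta> (if ?f Y < ?f X then Y else X) Ys)"
    by simp
  with is_arg_min_insert_step[OF Cons.IH, of X Y] show ?case
    by (simp only: list.set)
qed (simp add: is_arg_min_linorder)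

lemma set_list_stores: "set (fst (list_stores p ds)) = set_pieces p \<union> set ds"
  by (induction p arbitrary: ds) auto

definition final_cands :: "('a \<Rightarrow> real) \<Rightarrow> ('a \<Rightarrow> real) \<Rightarrow> 'a list \<Rightarrow> nat \<Rightarrow> 'a cand list" where
  "final_cands c \<rho> ds k = level_cands c \<rho> ds (2 ^ k) k ! 0"

lemma hd_merge_levels:
  "hd (fst (merge_levels (2 ^ k) k (fst (generate c \<rho> ds (2 ^ k) [])))) = final_cands c \<rho> ds k"
proof -
  have "length (level_cands c \<rho> ds (2 ^ k) k) = 1"
    by (simp add: length_level_cands)
  then show ?thesis
    by (metis final_cands_def fst_merge_levels hd_conv_nth length_0_conv level_cands_def zero_neq_one)
qed

text \<open>Hence starting \<open>best\<close> at \<open>empty_cand\<close> does not enlarge the set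
  searched. Without merges it is the empty prefix; otherwise \<open>merge\<close> puts it at the
  head.\<close>

lemma empty_cand_in_final_cands: "empty_cand \<in> set (final_cands c \<rho> ds k)"
proof (cases k)
  case 0
  have "empty_cand \<in> set (fst (prefixes c \<rho> j empty_cand es))" for j es
    by (cases es) auto
  then show ?thesis
    using 0 by (simp add: final_cands_def level_cands_def fst_generate class_cands_def)
next
  case (Suc l)
  then show ?thesis
    using nth_level_cands[of l k 0 c \<rho> ds] unfolding final_cands_def by (simp add: empty_cand_in_merge del: power_Suc)
qed

lemma final_cands_cand_for:
  assumes "distinct ds" "X \<in> set (final_cands c \<rho> ds k)"
  shows "cand_for c \<rho> (set ds) (2 ^ k) X"
proof -
  have "cand_for c \<rho> (cost_block (set ds) c 0 (2 ^ k)) (2 ^ k) X"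
    using level_cands_cand_for[OF assms(1), of k k 0] assms(2) by (simp add: final_cands_def)
  then show ?thesis
    by (auto simp: cand_for_def cost_block_def)
qed

lemma best_in_final_cands:
  "fst (best \<beta> empty_cand (final_cands c \<rho> ds k)) \<in> set (final_cands c \<rho> ds k)"
  using best_arg_min[of \<beta> empty_cand "final_cands c \<rho> ds k"]
  by (simp add: is_arg_min_def insert_absorb empty_cand_in_final_cands)

lemma pgm_output_pgm:
  assumes dist: "distinct ds" and \<beta>: "1 \<le> \<beta>" "log 2 \<beta> = 2 ^ k"
  shows "pgm_output (set ds) c \<rho> \<beta> (set (fst (pgm c \<rho> \<beta> ds)))"
proof -
  let ?F = "final_cands c \<rho> ds k"
  let ?X = "fst (best \<beta> empty_cand ?F)"
  have set_eq: "set (fst (pgm c \<rho> \<beta> ds)) = stores ?X"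
    by (simp add: pgm_def pgm_parameters(1,2)[OF \<beta>] hd_merge_levels set_list_stores)
  \<comment> \<open>On the final family the recorded numbers are the true expected costs, so
    minimising them minimises \<open>exp_cost\<close>.\<close>
  have "cand_cost X + \<beta> * cand_miss X = exp_cost c \<rho> \<beta> (stores X)" if "X \<in> set ?F" for X
    using final_cands_cand_for[OF dist that] by (simp add: cand_for_def exp_cost_def)
  then have "is_arg_min (exp_cost c \<rho> \<beta>) (\<lambda>D. D \<in> stores ` set ?F) (stores ?X)"
    using best_arg_min[of \<beta> empty_cand ?F] best_in_final_cands[of \<beta> c \<rho> ds k]
    by (auto simp: is_arg_min_linorder)
  then show ?thesis
    unfolding pgm_output_iff[OF \<beta>] set_eq
    using pgm_run_level_cands[OF dist, of c \<rho> k] unfolding final_cands_def by blast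
qed


section \<open>Running time\<close>

lemma snd_select_class: "snd (select_class c j ds) = 5 * length ds + 1"
  by (induction ds) simp_all

lemma snd_insert_by: "snd (insert_by \<rho> d es) \<le> 2 * length es + 2"
  by (induction es) auto

lemma snd_sort_by: "snd (sort_by \<rho> ds) \<le> 1 + 3 * length ds + 2 * length ds ^ 2"
proof (induction ds)
  case (Cons d ds)
  then show ?case
    using snd_insert_by[of \<rho> d "fst (sort_by \<rho> ds)"]
    by (simp add: power2_eq_square algebra_simps)
qed simp

lemma snd_prefixes: "snd (prefixes c \<rho> j X ds) = 10 * length ds + 1"
  by (induction ds arbitrary: X) simp_all

lemma length_class_cands: "length (class_cands c \<rho> ds j) = Suc (length (fst (select_class c j ds)))"
  by (simp add: class_cands_def)

text \<open>The classes are disjoint: the first \<open>j\<close> of them only contain stores of cost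
  below \<open>2 ^ j\<close>, and class \<open>j\<close> starts where these end.\<close>

lemma sum_length_select_class: "(\<Sum>i<j. length (fst (select_class c i ds))) \<le> length ds"
proof -
  have step: "length (filter (\<lambda>d. c d < 2 ^ j) ds) + length (fst (select_class c j ds)) \<le>
      length (filter (\<lambda>d. c d < 2 ^ Suc j) ds)" for j
  proof (induction ds)
    case (Cons d ds)
    have "c d < 2 ^ j \<Longrightarrow> c d < 2 * 2 ^ j"
      using zero_less_power[of "2::real" j] by linarith
    with Cons show ?case by auto
  qed simp
  have "(\<Sum>i<j. length (fst (select_class c i ds))) \<le> length (filter (\<lambda>d. c d < 2 ^ j) ds)"
  proof (induction j)
    case (Suc j)
    with step[of j] show ?case by simp
  qed simp
  also have "\<dots> \<le> length ds"
    by (rule length_filter_le)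
  finally show ?thesis .
qed

lemma snd_generate:
  "snd (generate c \<rho> ds j Vs) \<le> 1 + j * (5 * length ds + 4) + 15 * length ds ^ 2"
proof -
  let ?m = "\<lambda>i. length (fst (select_class c i ds))"
  have "snd (generate c \<rho> ds j Vs) \<le> 1 + j * (5 * length ds + 4) + 15 * (\<Sum>i<j. ?m i) ^ 2"
  proof (induction j arbitrary: Vs)
    case (Suc j)
    let ?V = "class_cands c \<rho> ds j"
    let ?S = "\<Sum>i<j. ?m i"
    have "snd (generate c \<rho> ds (Suc j) Vs) \<le>
        (5 * length ds + 1) + (1 + 3 * ?m j + 2 * ?m j ^ 2) + (10 * ?m j + 1) + 1 +
        snd (generate c \<rho> ds j (?V # Vs))"
      using snd_sort_by[of \<rho> "fst (select_class c j ds)"]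
      by (simp add: snd_select_class snd_prefixes class_cands_def)
    \<comment> \<open>The linear terms, 3 from sorting and 10 from the prefixes, are absorbed by
      \<open>m \<le> m ^ 2\<close> for natural \<open>m\<close>. The squares then combine because a
      sum of squares is at most the square of the sum.\<close>
    moreover have "13 * ?m j + 2 * ?m j ^ 2 + 15 * ?S ^ 2 \<le> 15 * ?m j ^ 2 + 15 * ?S ^ 2"
      by (simp add: power2_eq_square Suc_le_eq)
    moreover have "\<dots> \<le> 15 * (?S + ?m j) ^ 2"
      by (simp add: power2_eq_square algebra_simps)
    ultimately show ?case
      using Suc.IH[of "?V # Vs"] by simp
  qed simp
  moreover have "(\<Sum>i<j. ?m i) ^ 2 \<le> length ds ^ 2"
    using sum_length_select_class by (rule power_mono) simp
  ultimately show ?thesis by linarith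
qed

lemma snd_offer: "snd (offer r Z T) \<le> 5"
  by (simp add: offer_def)

text \<open>The constant 13 is 8 steps for \<open>join_cand\<close> plus at most 5 for
  \<open>offer\<close>.\<close>

lemma snd_scan_row: "snd (scan_row r X Ys T) \<le> 1 + 13 * length Ys"
proof (induction Ys arbitrary: T)
  case (Cons Y Ys)
  let ?Z = "fst (join_cand X Y)"
  show ?case
    using snd_offer[of r ?Z T] Cons[of "fst (offer r ?Z T)"] by simp
qed simp

lemma snd_scan: "snd (scan r Xs Ys T) \<le> 1 + length Xs * (1 + 13 * length Ys)"
proof (induction Xs arbitrary: T)
  case (Cons X Xs)
  show ?case
    using snd_scan_row[of r X Ys T] Cons[of "fst (scan_row r X Ys T)"] by simp
qed simp

lemma snd_collect: "snd (collect T t Zs) = 2 * t + 1"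
  by (induction t arbitrary: Zs) simp_all

lemma snd_merge: "snd (merge r Xs Ys) \<le> 3 * r + 4 + length Xs * (1 + 13 * length Ys)"
  using snd_scan[of r Xs Ys "\<lambda>_. None"] by (simp add: merge_def snd_collect)

text \<open>For the first level, whose lists have unbounded length but small total length.\<close>

lemma snd_merge_level_total:
  "snd (merge_level r Vs) \<le> 1 + length Vs * (3 * r + 5) + 7 * sum_list (map length Vs) ^ 2"
proof (induction r Vs rule: merge_level.induct)
  case (1 r U W Vs)
  let ?x = "length U" and ?y = "length W" and ?S = "sum_list (map length Vs)"
  have "?x * (1 + 13 * ?y) + 7 * ?S ^ 2 \<le> ?x ^ 2 + 13 * (?x * ?y) + 7 * ?S ^ 2"
    by (simp add: power2_eq_square algebra_simps Suc_le_eq)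
  \<comment> \<open>Expanding the square yields the mixed term \<open>14 * (?x * ?y)\<close>, which
    covers the 13 steps per pair.\<close>
  also have "\<dots> \<le> 7 * (?x + ?y + ?S) ^ 2"
    by (simp add: power2_eq_square algebra_simps)
  finally show ?case
    using snd_merge[of r U W] 1 by (simp add: add.assoc)
qed simp_all

lemma snd_merge_level_bounded:
  assumes "1 \<le> r" "\<forall>V\<in>set Vs. length V \<le> r + 1"
  shows "snd (merge_level r Vs) \<le> 1 + length Vs * (31 * r ^ 2)"
  using assms
proof (induction r Vs rule: merge_level.induct)
  case (1 r U W Vs)
  have r: "r \<le> r ^ 2" "1 \<le> r ^ 2"
    using "1.prems"(1) by (simp_all add: power2_eq_square)
  have "length U * (1 + 13 * length W) \<le> (2 * r) * (1 + 13 * (2 * r))"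
    using "1.prems" by (intro mult_mono add_mono) auto
  also have "\<dots> = 2 * r + 52 * r ^ 2"
    by (simp add: power2_eq_square algebra_simps)
  \<comment> \<open>The total is \<open>52 * r ^ 2 + 5 * r + 5\<close>, and
    \<open>1 \<le> r\<close>. A merge consumes two families, so each is charged
    \<open>31 * r ^ 2\<close>.\<close>
  finally have "snd (merge r U W) + 1 \<le> 62 * r ^ 2"
    using snd_merge[of r U W] r by linarith
  then show ?case
    using 1 by (simp add: add_mult_distrib)
qed simp_all

lemma length_in_merge_level: "V \<in> set (fst (merge_level r Vs)) \<Longrightarrow> length V \<le> r + 1"
proof (induction r Vs rule: merge_level.induct)
  case (1 r U W Vs)
  then show ?case
    using length_merge[of r U W] by auto
qed simp_all

text \<open>Geometric series: the number of families halves at each level, so the total is at most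
  twice the first level. Raising 31 to 32 pays for the additive 1 of each level.\<close>

lemma snd_merge_levels_bounded:
  assumes "1 \<le> r" "\<forall>V\<in>set Vs. length V \<le> r + 1" "length Vs = 2 ^ l"
  shows "snd (merge_levels r l Vs) \<le> 2 ^ Suc l * (32 * r ^ 2)"
  using assms(2,3)
proof (induction l arbitrary: Vs)
  case 0
  then show ?case
    using assms(1) one_le_power[of r 2] by simp
next
  case (Suc l)
  let ?Ws = "fst (merge_level r Vs)"
  have "snd (merge_levels r l ?Ws) \<le> 2 ^ Suc l * (32 * r ^ 2)"
    using Suc.prems length_in_merge_level[of _ r Vs]
    by (intro Suc.IH) (auto simp: length_merge_level)
  moreover have "snd (merge_level r Vs) \<le> 1 + 2 ^ Suc l * (31 * r ^ 2)"
    using snd_merge_level_bounded[OF assms(1) Suc.prems(1)] Suc.prems(2) by simp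
  moreover have "1 \<le> 2 ^ Suc l * r ^ 2"
    using assms(1) by simp
  moreover have "snd (merge_levels r (Suc l) Vs) = snd (merge_level r Vs) + snd (merge_levels r l ?Ws)"
    by simp
  moreover have "2 ^ Suc (Suc l) * (32 * r ^ 2) = 2 ^ Suc l * (31 * r ^ 2) + 2 ^ Suc l * r ^ 2 +
      2 ^ Suc l * (32 * r ^ 2)"
    by simp
  ultimately show ?case
    by linarith
qed

lemma sum_list_length_class_cands:
  "sum_list (map length (map (class_cands c \<rho> ds) [0..<j])) \<le> length ds + j"
proof -
  have "sum_list (map length (map (class_cands c \<rho> ds) [0..<j])) =
      (\<Sum>i<j. length (fst (select_class c i ds)) + 1)"
    by (simp add: comp_def length_class_cands interv_sum_list_conv_sum_set_nat atLeast0LessThan)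
  also have "\<dots> \<le> length ds + j"
    unfolding sum.distrib using sum_length_select_class[of c ds j] by simp
  finally show ?thesis .
qed

lemma snd_merge_levels:
  assumes "r = 2 ^ k" "Vs = map (class_cands c \<rho> ds) [0..<r]"
  shows "snd (merge_levels r k Vs) \<le> 1 + r * (3 * r + 5) + 7 * (length ds + r) ^ 2 + 32 * r ^ 3"
proof (cases k)
  case 0
  then show ?thesis by simp
next
  case (Suc l)
  have "snd (merge_levels r l (fst (merge_level r Vs))) \<le> 2 ^ Suc l * (32 * r ^ 2)"
    using assms Suc length_in_merge_level[of _ r Vs]
    by (intro snd_merge_levels_bounded) (auto simp: length_merge_level)
  also have "\<dots> = 32 * r ^ 3"
    unfolding Suc[symmetric] assms(1)[symmetric] by (simp add: power2_eq_square power3_eq_cube)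
  finally have "snd (merge_levels r k Vs) \<le> snd (merge_level r Vs) + 32 * r ^ 3"
    using Suc by simp
  moreover have "sum_list (map length Vs) ^ 2 \<le> (length ds + r) ^ 2"
    using sum_list_length_class_cands unfolding assms(2) by (rule power_mono) simp
  moreover have "snd (merge_level r Vs) \<le> 1 + r * (3 * r + 5) + 7 * sum_list (map length Vs) ^ 2"
    using snd_merge_level_total[of r Vs] unfolding assms(2) by simp
  ultimately show ?thesis
    by linarith
qed

text \<open>For \<open>k = 0\<close> no merge takes place and the result is a prefix family, which
  can have \<open>length ds + 1\<close> members; otherwise a merge bounds the size by
  \<open>r + 1\<close>.\<close>

lemma length_final_cands: "length (final_cands c \<rho> ds k) \<le> length ds + 2 ^ k + 1"
proof (cases k)
  case 0
  then show ?thesis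
    using sum_list_length_class_cands[of c \<rho> ds 1]
    by (simp add: final_cands_def level_cands_def fst_generate length_class_cands del: generate.simps)
next
  case (Suc l)
  then have "length (final_cands c \<rho> ds k) \<le> 2 ^ k + 1"
    using nth_level_cands[of l k 0 c \<rho> ds] length_merge[of "2 ^ k"]
    unfolding final_cands_def by (simp del: power_Suc)
  then show ?thesis
    by linarith
qed

lemma snd_best: "snd (best \<beta> X Ys) = 5 * length Ys + 1"
  by (induction Ys arbitrary: X) simp_all

lemma snd_list_stores: "snd (list_stores p ds) = 2 * num_joins p + 1"
  by (induction p arbitrary: ds) simp_all

lemma snd_pgm:
  assumes dist: "distinct ds" and \<beta>: "1 \<le> \<beta>" "log 2 \<beta> = 2 ^ k"
  shows "snd (pgm c \<rho> \<beta> ds) \<le> 100 * (length ds ^ 2 + (2 ^ k) ^ 3)"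
proof -
  define n where "n = length ds"
  define r :: nat where "r = 2 ^ k"
  let ?X = "fst (best \<beta> empty_cand (final_cands c \<rho> ds k))"
  let ?Vs = "fst (generate c \<rho> ds r [])"
  \<comment> \<open>Reading out the tree takes time proportional to its joins, not to the chosen
    set; the width \<open>r\<close> bounds the excess due to \<open>Nothing\<close> leaves.\<close>
  have joins: "num_joins (pieces ?X) \<le> n + r"
  proof -
    have "cand_for c \<rho> (set ds) r ?X"
      using final_cands_cand_for[OF dist best_in_final_cands] unfolding r_def .
    moreover from this have "card (stores ?X) \<le> n"
      using card_mono[of "set ds" "stores ?X"] card_length[of ds]
      unfolding n_def cand_for_def by fastforce
    ultimately show ?thesis
      by (simp add: cand_for_def)
  qed
  have "snd (pgm c \<rho> \<beta> ds) = 3 + snd (generate c \<rho> ds r []) + snd (merge_levels r k ?Vs) +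
      (5 * length (final_cands c \<rho> ds k) + 1) + (2 * num_joins (pieces ?X) + 1)"
    by (simp add: pgm_def pgm_parameters(1,2)[OF \<beta>] hd_merge_levels snd_best snd_list_stores r_def)
  also have "\<dots> \<le> 3 + (1 + r * (5 * n + 4) + 15 * n ^ 2) +
      (1 + r * (3 * r + 5) + 7 * (n + r) ^ 2 + 32 * r ^ 3) +
      (5 * (n + r + 1) + 1) + (2 * (n + r) + 1)"
    using snd_generate[of c \<rho> ds r "[]"] snd_merge_levels[OF r_def, of ?Vs c \<rho> ds]
      length_final_cands[of c \<rho> ds k] joins
    by (intro add_mono mult_le_mono le_refl) (simp_all add: fst_generate n_def r_def)
  also have "\<dots> = 12 + 16 * r + 7 * n + 19 * (r * n) + 22 * n ^ 2 + 10 * r ^ 2 + 32 * r ^ 3"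
    by (simp add: power2_eq_square algebra_simps)
  \<comment> \<open>The mixed term is split between the squares, giving 48 = 7 + 19 + 22 and 89 = 12
    + 16 + 19 + 10 + 32.\<close>
  also have "\<dots> \<le> 48 * n ^ 2 + 89 * r ^ 3"
  proof -
    have r1: "1 \<le> r"
      by (simp add: r_def)
    have "r * n \<le> n ^ 2 + r ^ 2"
      by (cases "r \<le> n") (auto simp: power2_eq_square intro: trans_le_add1 trans_le_add2 mult_le_mono)
    moreover have "n \<le> n ^ 2"
      by (simp add: power2_eq_square)
    moreover have "r \<le> r ^ 3" "r ^ 2 \<le> r ^ 3" "1 \<le> r ^ 3"
      using r1 power_increasing[of 1 3 r] by (simp_all add: power_increasing)
    ultimately show ?thesis by linarith
  qed
  also have "\<dots> \<le> 100 * (n ^ 2 + r ^ 3)"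
    by simp
  finally show ?thesis
    by (simp add: n_def r_def)
qed

section \<open>Assembly of the theorem\<close>

lemma pgm_output_approx_Min:
  assumes out: "pgm_output N c \<rho> \<beta> D" and fin: "finite N"
    and cost: "\<forall>d\<in>N. 1 \<le> c d" and miss: "\<forall>d\<in>N. 0 \<le> \<rho> d"
    and \<beta>: "1 \<le> \<beta>" "log 2 \<beta> = 2 ^ k"
  shows "exp_cost c \<rho> \<beta> D \<le> 2 * log 2 \<beta> * Min (exp_cost c \<rho> \<beta> ` Pow N)"
proof -
  have "Min (exp_cost c \<rho> \<beta> ` Pow N) \<in> exp_cost c \<rho> \<beta> ` Pow N"
    using fin by (intro Min_in) auto
  then obtain E where "E \<subseteq> N" "Min (exp_cost c \<rho> \<beta> ` Pow N) = exp_cost c \<rho> \<beta> E"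
    by auto
  then show ?thesis
    using pgm_output_approx(2)[OF out fin _ _ \<beta>] cost miss by auto
qed

lemma real_snd_pgm:
  assumes ds: "distinct ds" and \<beta>: "1 \<le> \<beta>" "log 2 \<beta> = 2 ^ k"
  shows "real (snd (pgm c \<rho> \<beta> ds)) \<le> 100 * (real (card (set ds)) ^ 2 + log 2 \<beta> ^ 3)"
proof -
  have "real (snd (pgm c \<rho> \<beta> ds)) \<le> real (100 * (card (set ds) ^ 2 + (2 ^ k) ^ 3))"
    using snd_pgm[OF assms, of c \<rho>] distinct_card[OF ds] by (metis of_nat_le_iff)
  then show ?thesis
    by (simp add: \<beta>(2))
qed

text \<open>The cost guarantee covers every execution, however ties are broken. The step-counted
  program \<open>pgm\<close> is shown to be one of these executions and so inherits it. The constant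
  100 serves all instances.\<close>

theorem theorem23:
  "\<exists>C :: real. \<forall>(N :: 'a set) (c :: 'a \<Rightarrow> real) (\<rho> :: 'a \<Rightarrow> real) (\<beta> :: real).
     finite N \<and> (\<forall>d\<in>N. 1 \<le> c d) \<and> (\<forall>d\<in>N. 0 \<le> \<rho> d \<and> \<rho> d < 1) \<and>
     1 \<le> \<beta> \<and> (\<exists>k :: nat. log 2 \<beta> = 2 ^ k) \<longrightarrow>
       (\<forall>D. pgm_output N c \<rho> \<beta> D \<longrightarrow>
          D \<subseteq> N \<and>
          exp_cost c \<rho> \<beta> D \<le> 2 * log 2 \<beta> * Min (exp_cost c \<rho> \<beta> ` Pow N)) \<and>
       (\<forall>ds. distinct ds \<and> set ds = N \<longrightarrow>
          pgm_output N c \<rho> \<beta> (set (fst (pgm c \<rho> \<beta> ds))) \<and>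
          real (snd (pgm c \<rho> \<beta> ds)) \<le> C * (real (card N) ^ 2 + log 2 \<beta> ^ 3))"
  by (intro exI[of _ 100])
    (metis pgm_output_approx(1) pgm_output_approx_Min pgm_output_pgm real_snd_pgm)

end
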